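(* Let $f(w)=\mathbb{E}_\zeta[F(w,\zeta)]$ satisfy the spectral upper bound condition with constant $L$, and suppose $f$ is bounded below by $f_{\min}$. For any $w_0\in\mathbb{R}^d$ let $\{w_k\}$ be generated by $w_{k+1}=w_k-\alpha_k\widetilde H_k^{-1}g_k$, and suppose that for every $k\ge0$ the gradient approximation satisfies the stochastic norm condition $$\mathbb{E}\big[\|g_k-\nabla f(w_k)\|_{A_k}^2\,\big|\,w_k,A_k\big]\le\theta_k^2\|\nabla f(w_k)\|_{A_k}^2+\iota_k$$ with $\iota_k>0$ and $\sum_{k=0}^\infty\iota_k=\tilde\iota<\infty$. Let $T$ be any positive integer. 1. If $A_k=\widetilde H_k^{-1}$, $\theta_k=\tilde\theta_g\in[0,1)$ and $\alpha_k=\alpha$ with $0<\alpha\le\tilde\mu/L$, then $$\min_{0\le k\le T-1}\mathbb{E}[\|\nabla f(w_k)\|^2]\le\frac{\tilde L}{(1-\tilde\theta_g^2)T}\left(\frac{2(f(w_0)-f_{\min})}{\alpha}+\tilde\iota\right).$$ 2. If $g_k$ is an unbiased estimator of $\nabla f(w_k)$, $\theta_k=\tilde\theta_g\ge0$, and either (a) $A_k=\widetilde H_k^{-1}$ and $\alpha_k=\alpha$ with $0<\alpha\le\frac{\tilde\mu}{L(1+\tilde\theta_g^2)}$, or (b) $A_k=I$ and $\alpha_k=\alpha$ with $0<\alpha\le\frac{\tilde\mu}{L\left(1+\tilde\theta_g^2\tilde L/\tilde\mu\right)}$, then $$\min_{0\le k\le T-1}\mathbb{E}[\|\nabla f(w_k)\|^2]\le\frac{\tilde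 L}{T}\left(\frac{2(f(w_0)-f_{\min})}{\alpha}+\frac{L\alpha\tilde\iota}{\tilde\mu\min\{1,\tilde\mu\}}\right).$$ Moreover, in each of these cases, $\sum_{k=0}^\infty\|\nabla f(w_k)\|^2<\infty$ almost surely, and consequently $\|\nabla f(w_k)\|^2\to0$ as $k\to\infty$ almost surely.
   Context: Setting: $F(\cdot,\zeta)$ is twice continuously differentiable, $F_i:=F(\cdot,\zeta_i)$ for i.i.d. samples $\zeta_i$ of $\zeta$, and for a finite sample set $S$, $F_S=\frac1{|S|}\sum_{i\in S}F_i$. The random vector $g_k\in\mathbb{R}^d$ is a stochastic approximation of $\nabla f(w_k)$; $g_k$ and the Hessian sample set $S_k$ are drawn independently given the past. "Unbiased" means $\mathbb{E}[g_k\mid w_k,\widetilde H_k]=\nabla f(w_k)$. Conditional expectations given $(w_k,A_k)$ are conditional on the algorithm having reached $w_k$ with matrix $A_k$ (i.e. on the whole history). $\mathbb{E}$ is expectation over all random variables. Hessian approximation: for each $k$ there are weights $\gamma_0,\dots,\gamma_k\in[0,1]$ (possibly depending on $k$) with $\sum_{i=0}^k\gamma_i=1$, and $\widehat H_k=\sum_{i=0}^k\gamma_i\nabla^2F_{S_i}(w_i)$. For symmetric $A=U\Lambda U^T$, $|A|=U|\Lambda|U^T$. For fixed $\tilde\mu>0$, $\widetilde H_k=|\widehat H_k|$ if $\lambda_{\min}(|\widehat H_k|)\ge\tilde\mu$, and $\widetilde H_k=|\widehat H_k|+(\tilde\mu-\lambda_{\min}(|\widehat H_k|))I$ otherwise;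 thus $\widetilde H_k\succeq\tilde\mu I$. Spectral upper bound condition: for every sample size $|S|$ there is $0<L_{|S|}<\infty$ with $\nabla^2F_S(w)\preceq L_{|S|}I$ for all $w\in\mathbb{R}^d$, and $L_{|S|}\le L<\infty$ for all $|S|$; consequently $\nabla^2f(w)\preceq LI$. $\tilde L$ denotes a constant with $\widetilde H_k\preceq\tilde LI$ for all $k$ (with $\tilde L\le L+\tilde\mu$). $\|\cdot\|$ is the Euclidean norm and $\|v\|_A=\sqrt{v^TAv}$. *)

theory Defs
  imports "HOL-Probability.Probability"
begin

section \<open>Calculus\<close>

definition grad :: "(real^'n \<Rightarrow> real) \<Rightarrow> real^'n \<Rightarrow> real^'n" where
  "grad f w = (THE D. GDERIV f w :> D)"

definition hessian :: "(real^'n \<Rightarrow> real) \<Rightarrow> real^'n \<Rightarrow> real^'n^'n" where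
  "hessian f w = jacobian (grad f) (at w)"

definition twice_cont_diff :: "(real^'n \<Rightarrow> real) \<Rightarrow> bool" where
  "twice_cont_diff f \<longleftrightarrow>
     (\<forall>w. f differentiable (at w)) \<and> (\<forall>w. grad f differentiable (at w)) \<and>
     continuous_on UNIV (hessian f)"


section \<open>Symmetric matrices\<close>

text \<open>The Loewner order; it is only applied to symmetric matrices.\<close>

definition loewner_le :: "real^'n^'n \<Rightarrow> real^'n^'n \<Rightarrow> bool" where
  "loewner_le A B \<longleftrightarrow> (\<forall>x. 0 \<le> x \<bullet> ((B - A) *v x))"

definition mnorm :: "real^'n^'n \<Rightarrow> real^'n \<Rightarrow> real" where
  "mnorm A v = sqrt (v \<bullet> (A *v v))"

definition diag :: "real^'n \<Rightarrow> real^'n^'n" where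
  "diag d = (\<chi> i j. if i = j then d $ i else 0)"

text \<open>For symmetric \<open>A\<close> the spectral decomposition \<open>A = U \<Lambda> U\<^sup>T\<close> exists, and
  \<open>U \<bar>\<Lambda>\<bar> U\<^sup>T\<close> does not depend on which decomposition is chosen.\<close>

definition mat_abs :: "real^'n^'n \<Rightarrow> real^'n^'n" where
  "mat_abs A = (SOME B. \<exists>U d. orthogonal_matrix U \<and>
      A = U ** diag d ** transpose U \<and>
      B = U ** diag (\<chi> i. \<bar>d $ i\<bar>) ** transpose U)"

definition lambda_min :: "real^'n^'n \<Rightarrow> real" where
  "lambda_min A = Min {c. \<exists>v. v \<noteq> 0 \<and> A *v v = c *\<^sub>R v}"

definition modified_abs :: "real \<Rightarrow> real^'n^'n \<Rightarrow> real^'n^'n" where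
  "modified_abs \<mu> A =
     (if \<mu> \<le> lambda_min (mat_abs A) then mat_abs A
      else mat_abs A + (\<mu> - lambda_min (mat_abs A)) *\<^sub>R mat 1)"


section \<open>Subsampling\<close>

text \<open>\<open>\<zeta> i\<close> is the \<open>i\<close>-th i.i.d. sample, a random variable on the underlying probability space;
  a sample set is a set of indices.\<close>

definition subsampled ::
  "(real^'n \<Rightarrow> 'z \<Rightarrow> real) \<Rightarrow> (nat \<Rightarrow> 'w \<Rightarrow> 'z) \<Rightarrow> nat set \<Rightarrow> 'w \<Rightarrow> real^'n \<Rightarrow> real" where
  "subsampled F \<zeta> S \<omega> w = (1 / real (card S)) * (\<Sum>i\<in>S. F w (\<zeta> i \<omega>))"

definition spectral_upper_bound ::
  "'w set \<Rightarrow> (real^'n \<Rightarrow> 'z \<Rightarrow> real) \<Rightarrow> (nat \<Rightarrow> 'w \<Rightarrow> 'z) \<Rightarrow> real \<Rightarrow> bool" where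
  "spectral_upper_bound \<Omega> F \<zeta> L \<longleftrightarrow>
     (\<exists>Ls :: nat \<Rightarrow> real. \<forall>n\<ge>1. 0 < Ls n \<and> Ls n \<le> L \<and>
        (\<forall>S. finite S \<and> card S = n \<longrightarrow>
          (\<forall>\<omega>\<in>\<Omega>. \<forall>w. loewner_le (hessian (subsampled F \<zeta> S \<omega>) w) (Ls n *\<^sub>R mat 1))))"

definition averaged_hessian ::
  "(real^'n \<Rightarrow> 'z \<Rightarrow> real) \<Rightarrow> (nat \<Rightarrow> 'w \<Rightarrow> 'z) \<Rightarrow> (nat \<Rightarrow> 'w \<Rightarrow> nat set) \<Rightarrow>
   (nat \<Rightarrow> nat \<Rightarrow> real) \<Rightarrow> (nat \<Rightarrow> 'w \<Rightarrow> real^'n) \<Rightarrow> nat \<Rightarrow> 'w \<Rightarrow> real^'n^'n" where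
  "averaged_hessian F \<zeta> S \<gamma> w k \<omega> =
     (\<Sum>i\<le>k. \<gamma> k i *\<^sub>R hessian (subsampled F \<zeta> (S i \<omega>) \<omega>) (w i \<omega>))"


section \<open>The history of the algorithm\<close>

text \<open>The information carried by a random sample set \<open>T\<close>: which indices were drawn and the values
  of the corresponding samples.\<close>

definition sample_events ::
  "'w measure \<Rightarrow> 'z measure \<Rightarrow> (nat \<Rightarrow> 'w \<Rightarrow> 'z) \<Rightarrow> ('w \<Rightarrow> nat set) \<Rightarrow> 'w set set" where
  "sample_events M Z \<zeta> T = sigma_sets (space M)
     {{\<omega> \<in> space M. i \<in> T \<omega> \<and> \<zeta> i \<omega> \<in> B} | i B. B \<in> sets Z}"

definition events_of :: "'w measure \<Rightarrow> ('w \<Rightarrow> 'b::topological_space) \<Rightarrow> 'w set set" where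
  "events_of M X = sets (vimage_algebra (space M) X borel)"

text \<open>The past when \<open>w k\<close> has been reached, before \<open>g k\<close> and the sample set \<open>S k\<close> are drawn.\<close>

definition past ::
  "'w measure \<Rightarrow> 'z measure \<Rightarrow> (nat \<Rightarrow> 'w \<Rightarrow> 'z) \<Rightarrow> (nat \<Rightarrow> 'w \<Rightarrow> nat set) \<Rightarrow>
   (nat \<Rightarrow> 'w \<Rightarrow> real^'n^'n) \<Rightarrow> (nat \<Rightarrow> 'w \<Rightarrow> real^'n) \<Rightarrow> (nat \<Rightarrow> 'w \<Rightarrow> real^'n) \<Rightarrow> nat \<Rightarrow> 'w measure"
  where
  "past M Z \<zeta> S H g w k = sigma (space M)
     ((\<Union>j\<le>k. events_of M (w j)) \<union>
      (\<Union>j<k. events_of M (g j) \<union> events_of M (H j) \<union> sample_events M Z \<zeta> (S j)))"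

text \<open>\<open>past_with M G X\<close> is the sigma-algebra generated by \<open>G\<close> together with \<open>X\<close>.\<close>

definition past_with ::
  "'w measure \<Rightarrow> 'w measure \<Rightarrow> ('w \<Rightarrow> 'b::topological_space) \<Rightarrow> 'w measure" where
  "past_with M G X = sigma (space M) (sets G \<union> events_of M X)"

definition cond_indep :: "'w measure \<Rightarrow> 'w measure \<Rightarrow> 'w set set \<Rightarrow> 'w set set \<Rightarrow> bool" where
  "cond_indep M G \<A> \<B> \<longleftrightarrow> (\<forall>a\<in>\<A>. \<forall>b\<in>\<B>. AE \<omega> in M.
     real_cond_exp M G (indicator (a \<inter> b)) \<omega> =
       real_cond_exp M G (indicator a) \<omega> * real_cond_exp M G (indicator b) \<omega>)"

text \<open>\<open>real_cond_exp\<close> is meaningful for integrable functions only, so integrability is part of the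
  notion of unbiasedness. The conditional expectation of a vector is taken componentwise.\<close>

definition unbiased_for ::
  "'w measure \<Rightarrow> 'w measure \<Rightarrow> ('w \<Rightarrow> real^'n) \<Rightarrow> ('w \<Rightarrow> real^'n) \<Rightarrow> bool" where
  "unbiased_for M G X Y \<longleftrightarrow> integrable M X \<and>
     (\<forall>i. AE \<omega> in M. real_cond_exp M G (\<lambda>\<omega>. X \<omega> $ i) \<omega> = Y \<omega> $ i)"

text \<open>The conditional expectation is taken in \<open>[0,\<infinity>]\<close>, so the bound includes its finiteness.\<close>

definition stoch_norm_cond ::
  "'w measure \<Rightarrow> 'w measure \<Rightarrow> ('w \<Rightarrow> real^'n^'n) \<Rightarrow> ('w \<Rightarrow> real^'n) \<Rightarrow> ('w \<Rightarrow> real^'n) \<Rightarrow>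
   real \<Rightarrow> real \<Rightarrow> bool" where
  "stoch_norm_cond M G A g v \<theta> \<iota> \<longleftrightarrow> (AE \<omega> in M.
     nn_cond_exp M (past_with M G A) (\<lambda>\<omega>. ennreal ((mnorm (A \<omega>) (g \<omega> - v \<omega>))\<^sup>2)) \<omega>
       \<le> ennreal (\<theta>\<^sup>2 * (mnorm (A \<omega>) (v \<omega>))\<^sup>2 + \<iota>))"

end

theory Submission
  imports Defs
begin

text \<open>Write \<open>V\<close> for the gradient at \<open>w k\<close>, \<open>P\<close> for the inverse of \<open>H k\<close> and \<open>e = g k - V\<close>.
  The quadratic upper bound of the objective along the step, combined with
  \<open>\<mu> * norm (P v)^2 \<le> v \<bullet> P v\<close>, bounds the decrease in terms of \<open>V \<bullet> P V\<close>, \<open>P V \<bullet> e\<close> and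
  \<open>e \<bullet> P e\<close>. In the biased case the cross terms are absorbed into a square; in the unbiased case
  \<open>P V\<close> is measurable with respect to the past and \<open>H k\<close>, so they vanish in expectation. Taking
  expectations and telescoping bounds the sum of the expected squared gradients. Integrability of the
  objective along the iterates is carried through the induction by
  \<open>norm V^2 \<le> 2 * L * (f (w k) - fmin)\<close>. The objective need not be assumed differentiable: the upper
  bound on the Hessians of the samples makes their second-order remainders convex, which gives
  dominated convergence for the difference quotients.\<close>

section \<open>Symmetric matrices\<close>

text \<open>Each bound on the step length compares the coefficient
  \<open>L * a^2 / (2 * \<mu>)\<close> of \<open>g \<bullet> P g\<close> with \<open>a / 2\<close>.
  In the biased case the coefficient is at most \<open>a / 2\<close>. In the unbiased case this
  still holds after multiplication by \<open>1 + c\<close>, where \<open>c\<close> is the share of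
  \<open>V \<bullet> P V\<close> in the expected error. In the biased case the error consumes the
  fraction \<open>\<theta>g^2\<close> of the decrease, which leaves the factor
  \<open>1 - \<theta>g^2\<close>. The factor \<open>Lt\<close> of the bounds comes from returning
  from \<open>V \<bullet> P V\<close> to the Euclidean norm, and \<open>min 1 \<mu>\<close> from
  treating \<open>\<iota> k\<close> and \<open>\<iota> k / \<mu>\<close> together. The norm
  condition bounds the expected error only in terms of the expectation of
  \<open>V \<bullet> P V\<close>, whose finiteness is derived from integrability of the objective at
  \<open>w k\<close>; so each step must deliver its inequality and the next integrability together.
  Since \<open>mat_abs\<close> is specified through a diagonalization, the spectral theorem and the
  symmetry of second derivatives have to precede any bound on \<open>H k\<close>.\<close>

lemma dot_symmetric_matrix:
  fixes A :: "real^'n^'n"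
  assumes "transpose A = A"
  shows "x \<bullet> (A *v y) = (A *v x) \<bullet> y"
  by (metis assms dot_lmul_matrix transpose_matrix_vector)

text \<open>The first-order condition for the Rayleigh quotient. Moving \<open>v\<close> by
  \<open>t y\<close> with \<open>y = c v - A v\<close>, which lies in \<open>V\<close> by
  invariance, turns the slack in \<open>quad\<close> into \<open>2 t |y|^2 + t^2 b\<close>; this is
  nonnegative for all \<open>t\<close> only if \<open>y = 0\<close>.\<close>

lemma maximizer_is_eigenvector:
  fixes A :: "real^'n^'n"
  assumes sym: "transpose A = A" and V: "subspace V" "\<And>x. x \<in> V \<Longrightarrow> A *v x \<in> V"
    and v: "v \<in> V" "norm v = 1"
    and max: "\<And>x. x \<in> V \<Longrightarrow> norm x = 1 \<Longrightarrow> x \<bullet> (A *v x) \<le> c" and c: "v \<bullet> (A *v v) = c"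
  shows "A *v v = c *\<^sub>R v"
proof -
  have quad: "x \<bullet> (A *v x) \<le> c * (norm x)\<^sup>2" if "x \<in> V" for x
  proof (cases "x = 0")
    case False
    have "(x /\<^sub>R norm x) \<bullet> (A *v (x /\<^sub>R norm x)) \<le> c"
      using that False V(1) by (intro max) (auto simp: subspace_scale)
    then show ?thesis
      using False by (simp add: matrix_vector_mult_scaleR field_simps power2_eq_square)
  qed simp
  define y where "y = c *\<^sub>R v - A *v v"
  have y: "y \<in> V" unfolding y_def using v V by (simp add: subspace_diff subspace_scale)
  define b where "b = c * (norm y)\<^sup>2 - y \<bullet> (A *v y)"
  have b: "b \<ge> 0" unfolding b_def using quad[OF y] by simp
  have pos: "0 \<le> 2 * t * (norm y)\<^sup>2 + t\<^sup>2 * b" for t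
  proof -
    have "v + t *\<^sub>R y \<in> V" using v y V by (simp add: subspace_add subspace_scale)
    from quad[OF this]
    have e1: "(v + t *\<^sub>R y) \<bullet> (A *v (v + t *\<^sub>R y)) \<le> c * (norm (v + t *\<^sub>R y))\<^sup>2" .
    have e2: "(norm (v + t *\<^sub>R y))\<^sup>2 = 1 + 2 * t * (v \<bullet> y) + t\<^sup>2 * (norm y)\<^sup>2"
      using v(2) unfolding power2_norm_eq_inner norm_eq_1
      by (simp add: inner_add_left inner_add_right inner_commute power2_eq_square algebra_simps)
    have e3: "(v + t *\<^sub>R y) \<bullet> (A *v (v + t *\<^sub>R y))
        = c + 2 * t * (y \<bullet> (A *v v)) + t\<^sup>2 * (y \<bullet> (A *v y))"
      using dot_symmetric_matrix[OF sym, of v y] c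
      by (simp add: matrix_vector_right_distrib matrix_vector_mult_scaleR inner_add_left
          inner_add_right power2_eq_square algebra_simps inner_commute)
    have "(norm y)\<^sup>2 = c * (v \<bullet> y) - y \<bullet> (A *v v)"
      unfolding power2_norm_eq_inner by (subst (2) y_def) (simp add: inner_diff_right inner_commute)
    then have "2 * t * (norm y)\<^sup>2 = 2 * t * (c * (v \<bullet> y) - y \<bullet> (A *v v))" by (rule arg_cong)
    with e1[unfolded e2 e3] show ?thesis unfolding b_def by (simp only: algebra_simps)
  qed
  have "norm y = 0"
  proof (rule ccontr)
    assume "norm y \<noteq> 0"
    then have n: "(norm y)\<^sup>2 > 0" by simp
    \<comment> \<open>A negative \<open>t\<close> with \<open>|t| * b\<close> below
      \<open>2 |y|^2\<close> contradicts \<open>pos\<close>; the \<open>+ 1\<close> keeps the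
      denominator positive when \<open>b = 0\<close>.\<close>
    define t where "t = - (norm y)\<^sup>2 / (b + 1)"
    have "2 * t * (norm y)\<^sup>2 + t\<^sup>2 * b = t * (2 * (norm y)\<^sup>2 + t * b)"
      by (simp add: power2_eq_square algebra_simps)
    moreover have "t < 0" using n b unfolding t_def by (simp add: divide_neg_pos)
    moreover have "2 * (norm y)\<^sup>2 + t * b > 0"
    proof -
      have "b / (b + 1) \<le> 1" using b by simp
      then have "(norm y)\<^sup>2 * (b / (b + 1)) \<le> (norm y)\<^sup>2 * 1" using n by (intro mult_left_mono) auto
      moreover have "t * b = - ((norm y)\<^sup>2 * (b / (b + 1)))" unfolding t_def by simp
      ultimately show ?thesis using n by linarith
    qed
    ultimately show False using pos[of t] mult_neg_pos by fastforce
  qed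
  then show ?thesis unfolding y_def by simp
qed

text \<open>Induction on the dimension, hence a statement about invariant subspaces: the quadratic
  form attains its maximum on the compact unit sphere of \<open>V\<close>, the maximizer is an
  eigenvector, and by symmetry its orthogonal complement in \<open>V\<close> is again invariant and
  of smaller dimension.\<close>

lemma symmetric_matrix_eigenbasis:
  fixes A :: "real^'n^'n"
  assumes sym: "transpose A = A"
  shows "subspace V \<Longrightarrow> (\<And>x. x \<in> V \<Longrightarrow> A *v x \<in> V) \<Longrightarrow>
    \<exists>B. B \<subseteq> V \<and> pairwise orthogonal B \<and> (\<forall>b\<in>B. norm b = 1 \<and> (\<exists>c. A *v b = c *\<^sub>R b)) \<and> span B = V"
proof (induction "dim V" arbitrary: V rule: less_induct)
  case less
  show ?case
  proof (cases "V = {0}")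
    case True
    then show ?thesis by (intro exI[of _ "{}"]) auto
  next
    case False
    let ?K = "V \<inter> sphere 0 1"
    have comp: "compact ?K" using less.prems(1) by (simp add: closed_subspace closed_Int_compact)
    obtain x where x: "x \<in> V" "x \<noteq> 0" using False less.prems(1) subspace_0 by blast
    then have "x /\<^sub>R norm x \<in> ?K" using less.prems(1) by (simp add: subspace_scale)
    then have "?K \<noteq> {}" by blast
    moreover have "continuous_on ?K (\<lambda>x. x \<bullet> (A *v x))"
      by (intro continuous_intros matrix_vector_mult_linear_continuous_on)
    ultimately obtain v where v: "v \<in> ?K" and max: "\<And>x. x \<in> ?K \<Longrightarrow> x \<bullet> (A *v x) \<le> v \<bullet> (A *v v)"
      using continuous_attains_sup[OF comp] by blast
    define c where "c = v \<bullet> (A *v v)"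
    have ev: "A *v v = c *\<^sub>R v"
      using v max by (intro maximizer_is_eigenvector[OF sym less.prems]) (auto simp: c_def)
    define W where "W = {x \<in> V. orthogonal v x}"
    have W: "subspace W" using less.prems(1) unfolding W_def subspace_def
      by (auto simp: orthogonal_clauses)
    have AW: "A *v x \<in> W" if "x \<in> W" for x
    proof -
      have "v \<bullet> (A *v x) = c * (v \<bullet> x)" using dot_symmetric_matrix[OF sym, of v x] ev by simp
      then show ?thesis using that less.prems(2) unfolding W_def by (auto simp: orthogonal_def)
    qed
    have nv: "v \<bullet> v = 1" "norm v = 1" "v \<in> V" using v by (auto simp: norm_eq_1)
    have "v \<notin> W" using nv unfolding W_def orthogonal_def by auto
    then have "W \<subset> V" using nv unfolding W_def by auto
    then have "dim W < dim V" using W less.prems(1)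
      by (metis dim_psubset span_eq_iff)
    from less.hyps[OF this W AW] obtain B where B: "B \<subseteq> W" "pairwise orthogonal B"
      "\<forall>b\<in>B. norm b = 1 \<and> (\<exists>c. A *v b = c *\<^sub>R b)" "span B = W" by blast
    have "V \<subseteq> span (insert v B)"
    proof
      fix x assume x: "x \<in> V"
      have "x - (v \<bullet> x) *\<^sub>R v \<in> W" using x nv less.prems(1) unfolding W_def
        by (auto simp: orthogonal_def inner_diff_right subspace_diff subspace_scale)
      then have "x - (v \<bullet> x) *\<^sub>R v \<in> span B" using B by simp
      then show "x \<in> span (insert v B)" unfolding span_insert by blast
    qed
    moreover have "span (insert v B) \<subseteq> V"
      using B(1) nv \<open>W \<subset> V\<close> less.prems(1) by (intro span_minimal) auto
    moreover have "pairwise orthogonal (insert v B)"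
      using B(1,2) unfolding pairwise_insert W_def by (auto simp: orthogonal_commute)
    ultimately show ?thesis
      using B nv ev \<open>W \<subset> V\<close> by (intro exI[of _ "insert v B"]) auto
  qed
qed

text \<open>Indexing the eigenvectors by \<open>'n\<close> itself lets them become the columns of a
  square matrix; the bijection exists because an independent spanning set has exactly
  \<open>CARD('n)\<close> elements.\<close>

lemma symmetric_matrix_orthonormal_eigenvectors:
  fixes A :: "real^'n^'n"
  assumes "transpose A = A"
  shows "\<exists>(u :: 'n \<Rightarrow> real^'n) d :: real^'n.
    (\<forall>i j. u i \<bullet> u j = (if i = j then 1 else 0)) \<and> (\<forall>i. A *v u i = d $ i *\<^sub>R u i)"
proof -
  obtain B :: "(real^'n) set" where B: "pairwise orthogonal B"
    "\<forall>b\<in>B. norm b = 1 \<and> (\<exists>c. A *v b = c *\<^sub>R b)" "span B = UNIV"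
    using symmetric_matrix_eigenbasis[OF assms, of UNIV] by auto
  have ind: "independent B" using B(1,2) by (intro pairwise_orthogonal_independent) auto
  have "card B = CARD('n)" using ind B(3) dim_eq_card[of B UNIV] by simp
  moreover have "finite B" using ind independent_imp_finite by blast
  ultimately obtain u where u: "bij_betw u (UNIV :: 'n set) B"
    by (metis finite_same_card_bij finite)
  have uB: "u i \<in> B" for i using u bij_betwE by blast
  have orth: "u i \<bullet> u j = (if i = j then 1 else 0)" for i j
  proof (cases "i = j")
    case True then show ?thesis using B(2) uB[of j] by (simp add: norm_eq_1)
  next
    case False
    then have "u i \<noteq> u j" using u by (auto simp: bij_betw_def inj_def)
    then show ?thesis using B(1) uB False by (auto simp: pairwise_def orthogonal_def)
  qed
  have "\<forall>i. \<exists>c. A *v u i = c *\<^sub>R u i" using B(2) uB by blast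
  then obtain c where "\<And>i. A *v u i = c i *\<^sub>R u i" by metis
  then have "A *v u i = (\<chi> i. c i) $ i *\<^sub>R u i" for i by simp
  with orth show ?thesis by blast
qed

section \<open>Orthogonal diagonalization and the modified absolute value\<close>

lemma diag_mult_vec: "diag d *v x = (\<chi> i. d $ i * x $ i)"
proof -
  have "(\<Sum>j\<in>UNIV. (if i = j then d $ i else 0) * x $ j) = d $ i * x $ i" for i
    by (subst sum.mono_neutral_right[of UNIV "{i}"]) auto
  then show ?thesis unfolding diag_def matrix_vector_mult_def by (simp add: vec_eq_iff)
qed

lemma transpose_diag: "transpose (diag d) = diag d"
  by (simp add: diag_def transpose_def vec_eq_iff)

lemma symmetric_matrix_diagonalization:
  fixes A :: "real^'n^'n"
  assumes "transpose A = A"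
  shows "\<exists>U d. orthogonal_matrix U \<and> A = U ** diag d ** transpose U"
proof -
  obtain u :: "'n \<Rightarrow> real^'n" and d :: "real^'n"
    where u: "\<forall>i j. u i \<bullet> u j = (if i = j then 1 else 0)"
    and ev: "\<forall>i. A *v u i = d $ i *\<^sub>R u i"
    using symmetric_matrix_orthonormal_eigenvectors[OF assms] by blast
  define U :: "real^'n^'n" where "U = (\<chi> i j. u j $ i)"
  have "transpose U ** U = mat 1"
    using u by (simp add: matrix_matrix_mult_def transpose_def U_def mat_def vec_eq_iff inner_vec_def)
  then have U: "orthogonal_matrix U" by (simp add: orthogonal_matrix)
  have "(A ** U) $ i $ j = (U ** diag d) $ i $ j" for i j
  proof -
    have "(A ** U) $ i $ j = (A *v u j) $ i"
      by (simp add: matrix_matrix_mult_def matrix_vector_mult_def U_def)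
    also have "\<dots> = d $ j * u j $ i" by (simp add: ev)
    also have "\<dots> = (\<Sum>k\<in>UNIV. u k $ i * (if k = j then d $ k else 0))"
      by (subst sum.mono_neutral_right[of UNIV "{j}"]) auto
    also have "\<dots> = (U ** diag d) $ i $ j"
      by (simp add: matrix_matrix_mult_def U_def diag_def)
    finally show ?thesis .
  qed
  then have "A ** U = U ** diag d" by (simp add: vec_eq_iff)
  then have "U ** diag d ** transpose U = A ** (U ** transpose U)" by (simp add: matrix_mul_assoc)
  then have "A = U ** diag d ** transpose U"
    using U by (simp add: orthogonal_matrix_def matrix_mul_rid)
  with U show ?thesis by blast
qed

text \<open>The diagonal is arbitrary so that the lemma applies to the absolute values in
  \<open>mat_abs\<close>. The third claim shows that the set inside \<open>lambda_min\<close> is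
  finite and nonempty, so that \<open>Min\<close> there is a genuine minimum.\<close>

lemma orthogonal_conj_diag:
  fixes U :: "real^'n^'n"
  assumes U: "orthogonal_matrix U" and A: "A = U ** diag d ** transpose U"
  shows "transpose A = A"
    and "x \<bullet> (A *v x) = (\<Sum>i\<in>UNIV. d $ i * ((transpose U *v x) $ i)\<^sup>2)"
    and "{c. \<exists>v. v \<noteq> 0 \<and> A *v v = c *\<^sub>R v} = range (($) d)"
    and "norm (transpose U *v x) = norm x"
proof -
  show "transpose A = A"
    unfolding A by (simp add: matrix_transpose_mul transpose_diag matrix_mul_assoc)
  have inv: "U ** transpose U = mat 1" "transpose U ** U = mat 1"
    using U by (auto simp: orthogonal_matrix_def)
  have Av: "A *v x = U *v (diag d *v (transpose U *v x))" for x
    by (simp only: A matrix_vector_mul_assoc matrix_mul_assoc)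
  show "x \<bullet> (A *v x) = (\<Sum>i\<in>UNIV. d $ i * ((transpose U *v x) $ i)\<^sup>2)"
  proof -
    have "x \<bullet> (A *v x) = (transpose U *v x) \<bullet> (diag d *v (transpose U *v x))"
      unfolding Av by (simp only: dot_lmul_matrix[symmetric] transpose_matrix_vector)
    then show ?thesis unfolding inner_vec_def diag_mult_vec by (simp add: power2_eq_square ac_simps)
  qed
  show nrm: "norm (transpose U *v x) = norm x" for x
    using U by (metis orthogonal_matrix_transpose orthogonal_transformation_matrix
        matrix_of_matrix_vector_mul matrix_vector_mul_linear orthogonal_transformation_norm)
  show "{c. \<exists>v. v \<noteq> 0 \<and> A *v v = c *\<^sub>R v} = range (($) d)"
  proof (intro set_eqI iffI)
    fix c assume "c \<in> {c. \<exists>v. v \<noteq> 0 \<and> A *v v = c *\<^sub>R v}"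
    then obtain v where v: "v \<noteq> 0" "A *v v = c *\<^sub>R v" by blast
    define y where "y = transpose U *v v"
    have "y \<noteq> 0" using nrm[of v] v by (auto simp: y_def)
    have "transpose U *v (A *v v) = diag d *v y"
      unfolding Av y_def by (simp add: matrix_vector_mul_assoc inv matrix_mul_assoc)
    then have "diag d *v y = c *\<^sub>R y" using v(2) by (simp add: y_def matrix_vector_mult_scaleR)
    then have *: "d $ i * y $ i = c * y $ i" for i
      unfolding diag_mult_vec by (simp add: vec_eq_iff)
    obtain i where "y $ i \<noteq> 0" using \<open>y \<noteq> 0\<close> by (auto simp: vec_eq_iff)
    with *[of i] show "c \<in> range (($) d)" by auto
  next
    fix c assume "c \<in> range (($) d)"
    then obtain i where c: "c = d $ i" by auto
    define v where "v = U *v axis i 1"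
    have tv: "transpose U *v v = axis i 1" unfolding v_def by (simp add: matrix_vector_mul_assoc inv)
    then have "v \<noteq> 0" by (auto simp: axis_eq_0_iff)
    moreover have "diag d *v axis i 1 = c *\<^sub>R axis i 1"
      unfolding diag_mult_vec c by (auto simp: vec_eq_iff axis_def)
    then have "A *v v = c *\<^sub>R v" unfolding Av tv by (simp add: matrix_vector_mult_scaleR v_def)
    ultimately show "c \<in> {c. \<exists>v. v \<noteq> 0 \<and> A *v v = c *\<^sub>R v}" by blast
  qed
qed

text \<open>A diagonalization exists, so the \<open>SOME\<close> in \<open>mat_abs\<close> yields a
  matrix with some \<open>U\<close> and \<open>d\<close> of its own. In these coordinates the
  quadratic form is a sum of squares with weights \<open>|d i|\<close>, bounded below through the
  least weight; if that weight is below \<open>\<mu>\<close>, the added multiple of the identity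
  lifts the bound to \<open>\<mu>\<close>.\<close>

lemma modified_abs_symmetric_lower_bound:
  fixes A :: "real^'n^'n"
  assumes "transpose A = A"
  shows "transpose (modified_abs \<mu> A) = modified_abs \<mu> A"
    and "\<mu> * (norm x)\<^sup>2 \<le> x \<bullet> (modified_abs \<mu> A *v x)"
proof -
  obtain U0 d0 where "orthogonal_matrix U0" "A = U0 ** diag d0 ** transpose U0"
    using symmetric_matrix_diagonalization[OF assms] by blast
  then have "\<exists>B U d. orthogonal_matrix U \<and> A = U ** diag d ** transpose U \<and>
      B = U ** diag (\<chi> i. \<bar>d $ i\<bar>) ** transpose U" by blast
  then have "\<exists>U d. orthogonal_matrix U \<and> A = U ** diag d ** transpose U \<and>
      mat_abs A = U ** diag (\<chi> i. \<bar>d $ i\<bar>) ** transpose U"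
    unfolding mat_abs_def by (rule someI_ex)
  then obtain U d where U: "orthogonal_matrix U"
    and B: "mat_abs A = U ** diag (\<chi> i. \<bar>d $ i\<bar>) ** transpose U" by blast
  define e :: "real^'n" where "e = (\<chi> i. \<bar>d $ i\<bar>)"
  note spec = orthogonal_conj_diag[OF U B[folded e_def]]
  have lmin: "lambda_min (mat_abs A) = Min (range (($) e))"
    unfolding lambda_min_def spec(3) ..
  have quad: "lambda_min (mat_abs A) * (norm x)\<^sup>2 \<le> x \<bullet> (mat_abs A *v x)" for x
  proof -
    have "(norm x)\<^sup>2 = (\<Sum>i\<in>UNIV. ((transpose U *v x) $ i)\<^sup>2)"
      by (subst spec(4)[of x, symmetric])
        (simp add: norm_vec_def L2_set_def sum_nonneg del: transpose_matrix_vector)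
    then have "lambda_min (mat_abs A) * (norm x)\<^sup>2
        = (\<Sum>i\<in>UNIV. lambda_min (mat_abs A) * ((transpose U *v x) $ i)\<^sup>2)"
      by (simp add: sum_distrib_left del: transpose_matrix_vector)
    also have "\<dots> \<le> (\<Sum>i\<in>UNIV. e $ i * ((transpose U *v x) $ i)\<^sup>2)"
      unfolding lmin by (intro sum_mono mult_right_mono Min_le) auto
    finally show ?thesis unfolding spec(2) .
  qed
  have "transpose (mat_abs A + c *\<^sub>R mat 1) = mat_abs A + c *\<^sub>R mat 1" for c
    using spec(1) by (simp add: vec_eq_iff transpose_def mat_def)
  then show "transpose (modified_abs \<mu> A) = modified_abs \<mu> A"
    using spec(1) by (simp add: modified_abs_def)
  show "\<mu> * (norm x)\<^sup>2 \<le> x \<bullet> (modified_abs \<mu> A *v x)"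
  proof (cases "\<mu> \<le> lambda_min (mat_abs A)")
    case True
    then have "\<mu> * (norm x)\<^sup>2 \<le> lambda_min (mat_abs A) * (norm x)\<^sup>2" by (intro mult_right_mono) auto
    with quad[of x] True show ?thesis by (simp add: modified_abs_def)
  next
    case False
    have "(c *\<^sub>R mat 1) *v x = c *\<^sub>R x" for c :: real
      by (simp add: scaleR_matrix_vector_assoc[symmetric])
    with quad[of x] False show ?thesis
      by (simp add: modified_abs_def matrix_vector_mult_add_rdistrib inner_add_right
          power2_norm_eq_inner[symmetric] algebra_simps)
  qed
qed

text \<open>The lower bound on \<open>H\<close> is used at the point \<open>P x\<close>, where
  \<open>H (P x) = x\<close>; Cauchy-Schwarz then bounds \<open>norm (P x)\<close>. For the last
  claim the form of \<open>H\<close> is evaluated at a point that completes a square, which takes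
  the place of a matrix square root.\<close>

lemma inverse_between:
  fixes H :: "real^'n^'n"
  assumes sym: "transpose H = H" and \<mu>: "0 < \<mu>"
    and lower: "\<And>x. \<mu> * (norm x)\<^sup>2 \<le> x \<bullet> (H *v x)"
    and upper: "\<And>x. x \<bullet> (H *v x) \<le> K * (norm x)\<^sup>2"
  defines "P \<equiv> matrix_inv H"
  shows "det H \<noteq> 0" and "H *v (P *v x) = x"
    and "x \<bullet> (P *v y) = (P *v x) \<bullet> y"
    and "\<mu> * (norm (P *v x))\<^sup>2 \<le> x \<bullet> (P *v x)"
    and "\<mu> * norm (P *v x) \<le> norm x"
    and "\<mu> * (x \<bullet> (P *v x)) \<le> (norm x)\<^sup>2"
    and "0 < K" and "(norm x)\<^sup>2 \<le> K * (x \<bullet> (P *v x))"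
proof -
  have "\<forall>x. H *v x = 0 \<longrightarrow> x = 0"
  proof (intro allI impI)
    fix x assume "H *v x = 0"
    then have "\<mu> * (norm x)\<^sup>2 \<le> 0" using lower[of x] by simp
    then show "x = 0" using \<mu> by (simp add: mult_le_0_iff)
  qed
  then have "invertible H"
    using matrix_left_invertible_ker[of H] invertible_left_inverse[of H] by simp
  then show "det H \<noteq> 0" by (simp add: invertible_det_nz)
  have HP: "H ** P = mat 1"
    using someI_ex[OF \<open>invertible H\<close>[unfolded invertible_def]]
    unfolding P_def matrix_inv_def by (rule conjunct1)
  then show 1: "H *v (P *v x) = x" for x by (simp add: matrix_vector_mul_assoc)
  show 2: "x \<bullet> (P *v y) = (P *v x) \<bullet> y" for x y
    using dot_symmetric_matrix[OF sym, of "P *v x" "P *v y"] by (simp add: 1)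
  show 3: "\<mu> * (norm (P *v x))\<^sup>2 \<le> x \<bullet> (P *v x)" for x
    using lower[of "P *v x"] by (simp add: 1 inner_commute)
  show 4: "\<mu> * norm (P *v x) \<le> norm x" for x
  proof (cases "P *v x = 0")
    case False
    have "\<mu> * (norm (P *v x))\<^sup>2 \<le> norm x * norm (P *v x)"
      using 3[of x] norm_cauchy_schwarz[of x "P *v x"] by linarith
    then have "(\<mu> * norm (P *v x)) * norm (P *v x) \<le> norm x * norm (P *v x)"
      by (simp add: power2_eq_square mult.assoc)
    then show ?thesis using False by simp
  qed simp
  show "\<mu> * (x \<bullet> (P *v x)) \<le> (norm x)\<^sup>2"
  proof -
    have "\<mu> * (x \<bullet> (P *v x)) \<le> \<mu> * (norm x * norm (P *v x))"
      using \<mu> by (intro mult_left_mono norm_cauchy_schwarz) auto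
    also have "\<dots> \<le> norm x * norm x"
      using mult_left_mono[OF 4[of x], of "norm x"] by (simp add: ac_simps)
    finally show ?thesis by (simp add: power2_eq_square)
  qed
  \<comment> \<open>Any unit vector compares the two bounds; \<open>undefined\<close> is just some
    index of the nonempty type \<open>'n\<close>.\<close>
  have "\<mu> \<le> K" using lower[of "axis undefined 1"] upper[of "axis undefined 1"]
    by (simp add: norm_axis_1)
  then show K: "0 < K" using \<mu> by simp
  show "(norm x)\<^sup>2 \<le> K * (x \<bullet> (P *v x))"
  proof -
    \<comment> \<open>Nonnegativity of \<open>y \<bullet> H y\<close> reads \<open>2 / K * |x|^2
      \<le> x \<bullet> P x + (x \<bullet> H x) / K^2\<close>, and the upper bound on
      \<open>H\<close> makes the last term at most \<open>|x|^2 / K\<close>.\<close>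
    define y where "y = P *v x - (1 / K) *\<^sub>R x"
    have "0 \<le> y \<bullet> (H *v y)" by (rule order_trans[OF _ lower]) (use \<mu> in simp)
    also have "y \<bullet> (H *v y) = y \<bullet> (x - (1 / K) *\<^sub>R (H *v x))"
      by (simp add: y_def matrix_vector_mult_diff_distrib matrix_vector_mult_scaleR 1)
    also have "\<dots> = (P *v x) \<bullet> x - (1 / K) * ((P *v x) \<bullet> (H *v x)) - (1 / K) * (x \<bullet> x)
        + (1 / K)\<^sup>2 * (x \<bullet> (H *v x))"
      unfolding y_def inner_diff_left inner_diff_right inner_scaleR_left inner_scaleR_right power2_eq_square
      by algebra
    also have "(P *v x) \<bullet> (H *v x) = x \<bullet> x"
      using dot_symmetric_matrix[OF sym, of "P *v x" x] by (simp add: 1)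
    also have "(P *v x) \<bullet> x - (1 / K) * (x \<bullet> x) - (1 / K) * (x \<bullet> x) + (1 / K)\<^sup>2 * (x \<bullet> (H *v x))
        = x \<bullet> (P *v x) - 2 / K * (norm x)\<^sup>2 + (1 / K)\<^sup>2 * (x \<bullet> (H *v x))"
      by (simp add: power2_norm_eq_inner inner_commute)
    also have "\<dots> \<le> x \<bullet> (P *v x) - 2 / K * (norm x)\<^sup>2 + (1 / K)\<^sup>2 * (K * (norm x)\<^sup>2)"
      by (intro add_left_mono mult_left_mono upper) auto
    also have "\<dots> = x \<bullet> (P *v x) - (norm x)\<^sup>2 / K"
      using K by (simp add: power2_eq_square field_simps)
    finally show ?thesis using K by (simp add: field_simps)
  qed
qed

section \<open>Gradients and Hessians\<close>

lemma grad_eqI: "GDERIV f w :> D \<Longrightarrow> grad f w = D"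
proof -
  assume D: "GDERIV f w :> D"
  have "D' = D" if "GDERIV f w :> D'" for D'
  proof -
    have "(\<lambda>h. h \<bullet> D') = (\<lambda>h. h \<bullet> D)"
      using has_derivative_unique D that unfolding gderiv_def by blast
    then show ?thesis by (metis inner_eq_zero_iff inner_diff_right right_minus_eq)
  qed
  with D show ?thesis unfolding grad_def by (rule the_equality)
qed

lemma GDERIV_grad:
  fixes f :: "real^'n \<Rightarrow> real"
  assumes "f differentiable (at w)"
  shows "GDERIV f w :> grad f w"
proof -
  obtain f' where f': "(f has_derivative f') (at w)" using assms unfolding differentiable_def by blast
  then have lin: "linear f'" by (rule has_derivative_linear)
  have "f' h = h \<bullet> (\<chi> i. f' (axis i 1))" for h
  proof -
    have "f' h = f' (\<Sum>i\<in>UNIV. h $ i *\<^sub>R axis i 1)"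
      using basis_expansion[of h] by (simp add: scalar_mult_eq_scaleR)
    also have "\<dots> = (\<Sum>i\<in>UNIV. h $ i * f' (axis i 1))"
      using lin by (simp add: linear_sum linear_scale)
    finally show ?thesis by (simp add: inner_vec_def)
  qed
  then have "f' = (\<lambda>h. h \<bullet> (\<chi> i. f' (axis i 1)))" by blast
  then have "GDERIV f w :> (\<chi> i. f' (axis i 1))" using f' unfolding gderiv_def by metis
  then show ?thesis using grad_eqI by metis
qed

lemma has_derivative_grad:
  fixes f :: "real^'n \<Rightarrow> real"
  assumes "f differentiable (at w)"
  shows "(f has_derivative (\<lambda>h. h \<bullet> grad f w)) (at w)"
  using GDERIV_grad[OF assms] unfolding gderiv_def .

lemma DERIV_along_line:
  fixes f :: "real^'n \<Rightarrow> real"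
  assumes "\<And>w. f differentiable (at w)"
  shows "((\<lambda>t. f (w + t *\<^sub>R h)) has_real_derivative (h \<bullet> grad f (w + t *\<^sub>R h))) (at t)"
proof -
  have "((\<lambda>t. f (w + t *\<^sub>R h)) has_derivative (\<lambda>s. (s *\<^sub>R h) \<bullet> grad f (w + t *\<^sub>R h))) (at t)"
    by (rule has_derivative_compose[OF _ has_derivative_grad[OF assms], of "\<lambda>t. w + t *\<^sub>R h"])
      (auto intro!: derivative_eq_intros)
  then show ?thesis by (simp add: has_field_derivative_def mult_commute_abs)
qed

lemma has_derivative_hessian:
  fixes f :: "real^'n \<Rightarrow> real"
  assumes "grad f differentiable (at w)"
  shows "(grad f has_derivative (\<lambda>h. hessian f w *v h)) (at w)"
  using assms unfolding hessian_def jacobian_works .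

text \<open>The quotient is symmetric in \<open>u\<close> and \<open>v\<close> while its limit is
  not visibly so; this is the source of the symmetry of the Hessian. The mean value theorem in
  direction \<open>u\<close> reduces it to gradients at two points near \<open>w\<close>, where the
  first-order expansion of the gradient at \<open>w\<close> applies.\<close>

lemma second_difference_hessian:
  fixes f :: "real^'n \<Rightarrow> real"
  assumes f: "\<And>w. f differentiable (at w)" and g: "grad f differentiable (at w)"
  shows "((\<lambda>t. (f (w + t *\<^sub>R u + t *\<^sub>R v) - f (w + t *\<^sub>R u) - f (w + t *\<^sub>R v) + f w) / t\<^sup>2)
    \<longlongrightarrow> u \<bullet> (hessian f w *v v)) (at_right 0)"
proof (rule tendstoI)
  fix e :: real assume e: "0 < e"
  \<comment> \<open>The two remainders of the gradient are at most \<open>e / (2 C)\<close> times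
    \<open>t (|u| + |v|)\<close> and \<open>t |u|\<close>; paired with \<open>u\<close> and divided
    by \<open>t\<close> they add up to at most \<open>e / 2 * (C - 1) / C\<close>. The
    \<open>+ 1\<close> makes \<open>C\<close> positive for \<open>u = 0\<close>.\<close>
  define C where "C = norm u * (2 * norm u + norm v) + 1"
  have C: "C > 0" unfolding C_def by (smt (verit) mult_nonneg_nonneg norm_ge_zero)
  let ?H = "hessian f w"
  obtain d where d: "d > 0" and
    der: "\<And>y. norm (y - w) < d \<Longrightarrow>
      norm (grad f y - grad f w - ?H *v (y - w)) \<le> (e / C / 2) * norm (y - w)"
    using has_derivative_hessian[OF g] e C unfolding has_derivative_at_alt
    by (metis divide_pos_pos zero_less_numeral)
  define r where "r y = grad f y - grad f w - ?H *v (y - w)" for y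
  \<comment> \<open>For \<open>t < t0\<close> both evaluation points \<open>p\<close> and
    \<open>q\<close> lie within \<open>d\<close> of \<open>w\<close>.\<close>
  define t0 where "t0 = d / (norm u + norm v + 1)"
  have t0: "t0 > 0" unfolding t0_def using d by (intro divide_pos_pos) (auto simp: add_nonneg_pos)
  have "dist ((f (w + t *\<^sub>R u + t *\<^sub>R v) - f (w + t *\<^sub>R u) - f (w + t *\<^sub>R v) + f w) / t\<^sup>2)
      (u \<bullet> (?H *v v)) < e" if t: "0 < t" "t < t0" for t
  proof -
    \<comment> \<open>The second difference is the increment over \<open>[0, t]\<close> of
      \<open>s \<mapsto> f (w + t v + s u) - f (w + s u)\<close>.\<close>
    have "\<exists>z. 0 < z \<and> z < t \<and>
        (f (w + t *\<^sub>R v + t *\<^sub>R u) - f (w + t *\<^sub>R u)) - (f (w + t *\<^sub>R v + 0 *\<^sub>R u) - f (w + 0 *\<^sub>R u)) =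
        (t - 0) * (u \<bullet> grad f (w + t *\<^sub>R v + z *\<^sub>R u) - u \<bullet> grad f (w + z *\<^sub>R u))"
      by (rule MVT2[OF t(1), of "\<lambda>s. f (w + t *\<^sub>R v + s *\<^sub>R u) - f (w + s *\<^sub>R u)"])
        (intro DERIV_diff DERIV_along_line f)
    then obtain z where z: "0 < z" "z < t" and
      mvt: "f (w + t *\<^sub>R u + t *\<^sub>R v) - f (w + t *\<^sub>R u) - f (w + t *\<^sub>R v) + f w =
        t * (u \<bullet> grad f (w + t *\<^sub>R v + z *\<^sub>R u) - u \<bullet> grad f (w + z *\<^sub>R u))"
      by (auto simp: add_ac)
    define p q where "p = w + t *\<^sub>R v + z *\<^sub>R u" and "q = w + z *\<^sub>R u"
    have small: "t * (norm u + norm v) < d"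
    proof -
      have "t * (norm u + norm v) \<le> t * (norm u + norm v + 1)" using t by (intro mult_left_mono) auto
      also have "\<dots> < t0 * (norm u + norm v + 1)"
        using t by (intro mult_strict_right_mono) (auto simp: add_nonneg_pos)
      also have "\<dots> = d" unfolding t0_def by (simp add: add_nonneg_pos[THEN less_imp_neq, symmetric] add_nonneg_pos)
      finally show ?thesis .
    qed
    have np: "norm (p - w) \<le> t * (norm u + norm v)"
    proof -
      have "norm (p - w) \<le> norm (t *\<^sub>R v) + norm (z *\<^sub>R u)"
        unfolding p_def using norm_triangle_ineq[of "t *\<^sub>R v" "z *\<^sub>R u"] by simp
      also have "\<dots> \<le> t * norm v + t * norm u" using z t by (auto intro!: mult_right_mono)
      finally show ?thesis by (simp add: algebra_simps)
    qed
    have nq: "norm (q - w) \<le> t * norm u" unfolding q_def using z by (auto intro!: mult_right_mono)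
    then have nq': "norm (q - w) < d" using small t
      by (smt (verit, best) distrib_left mult_nonneg_nonneg norm_ge_zero)
    have rp: "norm (r p) \<le> (e / C / 2) * (t * (norm u + norm v))"
      unfolding r_def using der[of p] np small mult_left_mono[OF np, of "e / C / 2"] e C by force
    have rq: "norm (r q) \<le> (e / C / 2) * (t * norm u)"
      unfolding r_def using der[OF nq'] mult_left_mono[OF nq, of "e / C / 2"] e C by force
    have "grad f p - grad f q = t *\<^sub>R (?H *v v) + (r p - r q)"
      unfolding r_def p_def q_def
      by (simp add: matrix_vector_right_distrib matrix_vector_mult_scaleR algebra_simps)
    then have "u \<bullet> grad f p - u \<bullet> grad f q = t * (u \<bullet> (?H *v v)) + u \<bullet> (r p - r q)"
      by (simp add: inner_diff_right[symmetric] inner_add_right)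
    then have "(f (w + t *\<^sub>R u + t *\<^sub>R v) - f (w + t *\<^sub>R u) - f (w + t *\<^sub>R v) + f w) / t\<^sup>2
        - u \<bullet> (?H *v v) = (u \<bullet> (r p - r q)) / t"
      using t unfolding mvt p_def[symmetric] q_def[symmetric] by (simp add: field_simps power2_eq_square)
    moreover have bound: "\<bar>u \<bullet> (r p - r q)\<bar> \<le> norm u * ((e / C / 2) * (t * (norm u + norm v)) + (e / C / 2) * (t * norm u))"
    proof -
      have "\<bar>u \<bullet> (r p - r q)\<bar> \<le> norm u * norm (r p - r q)" by (rule Cauchy_Schwarz_ineq2)
      also have "norm (r p - r q) \<le> (e / C / 2) * (t * (norm u + norm v)) + (e / C / 2) * (t * norm u)"
        using norm_triangle_ineq4[of "r p" "r q"] rp rq by linarith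
      finally show ?thesis by (simp add: mult_left_mono)
    qed
    moreover have "norm u * ((e / C / 2) * (t * (norm u + norm v)) + (e / C / 2) * (t * norm u)) / t < e"
    proof -
      have "norm u * (x * (t * (norm u + norm v)) + x * (t * norm u)) = t * (x * (C - 1))" for x
        unfolding C_def by (simp add: algebra_simps)
      note eq = this
      have "norm u * ((e / C / 2) * (t * (norm u + norm v)) + (e / C / 2) * (t * norm u)) / t
          = e / 2 * ((C - 1) / C)"
        unfolding eq using t by simp
      also have "\<dots> \<le> e / 2 * 1" using e C by (intro mult_left_mono) auto
      finally show ?thesis using e by linarith
    qed
    moreover have "\<bar>(u \<bullet> (r p - r q)) / t\<bar> \<le>
        norm u * ((e / C / 2) * (t * (norm u + norm v)) + (e / C / 2) * (t * norm u)) / t"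
      using bound t by (simp add: divide_right_mono del: times_divide_eq_right times_divide_eq_left)
    ultimately show ?thesis unfolding dist_real_def by linarith
  qed
  then show "\<forall>\<^sub>F t in at_right 0. dist ((f (w + t *\<^sub>R u + t *\<^sub>R v) - f (w + t *\<^sub>R u)
      - f (w + t *\<^sub>R v) + f w) / t\<^sup>2) (u \<bullet> (?H *v v)) < e"
    using t0 unfolding eventually_at_right_field by blast
qed

text \<open>The second difference is unchanged when \<open>u\<close> and \<open>v\<close> are
  exchanged, so its two limits coincide.\<close>

lemma hessian_symmetric:
  fixes f :: "real^'n \<Rightarrow> real"
  assumes f: "\<And>w. f differentiable (at w)" and g: "grad f differentiable (at w)"
  shows "transpose (hessian f w) = hessian f w"
proof -
  have "u \<bullet> (hessian f w *v v) = v \<bullet> (hessian f w *v u)" for u v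
  proof (rule tendsto_unique[OF _ second_difference_hessian[OF f g]])
    show "((\<lambda>t. (f (w + t *\<^sub>R u + t *\<^sub>R v) - f (w + t *\<^sub>R u) - f (w + t *\<^sub>R v) + f w) / t\<^sup>2)
        \<longlongrightarrow> v \<bullet> (hessian f w *v u)) (at_right 0)"
      using second_difference_hessian[OF f g, of v u] by (simp add: algebra_simps)
  qed simp
  from this[of "axis _ 1" "axis _ 1"] show ?thesis
    by (simp add: vec_eq_iff transpose_def inner_axis' matrix_vector_mul_component inner_axis)
qed

text \<open>Two monotonicity arguments along the ray replace Taylor's formula: the Hessian bound
  makes the slope, corrected by its permitted growth, nonincreasing, and this in turn makes the
  corrected value nonincreasing.\<close>

lemma quadratic_upper_bound:
  fixes f :: "real^'n \<Rightarrow> real"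
  assumes f: "\<And>w. f differentiable (at w)" and g: "\<And>w. grad f differentiable (at w)"
    and H: "\<And>w. loewner_le (hessian f w) (L *\<^sub>R mat 1)"
  shows "f (w + h) \<le> f w + h \<bullet> grad f w + L / 2 * (norm h)\<^sup>2"
proof -
  define p where "p t = h \<bullet> grad f (w + t *\<^sub>R h) - t * (L * (norm h)\<^sup>2)" for t
  have dp: "(p has_real_derivative (h \<bullet> (hessian f (w + t *\<^sub>R h) *v h) - L * (norm h)\<^sup>2)) (at t)" for t
  proof -
    have "((\<lambda>t. grad f (w + t *\<^sub>R h)) has_derivative
        (\<lambda>s. hessian f (w + t *\<^sub>R h) *v (s *\<^sub>R h))) (at t)"
      by (rule has_derivative_compose[OF _ has_derivative_hessian[OF g], of "\<lambda>t. w + t *\<^sub>R h"])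
        (auto intro!: derivative_eq_intros)
    then have "((\<lambda>t. h \<bullet> grad f (w + t *\<^sub>R h)) has_derivative
        (\<lambda>s. h \<bullet> (hessian f (w + t *\<^sub>R h) *v (s *\<^sub>R h)))) (at t)"
      by (rule has_derivative_inner_right)
    then have "((\<lambda>t. h \<bullet> grad f (w + t *\<^sub>R h)) has_real_derivative
        h \<bullet> (hessian f (w + t *\<^sub>R h) *v h)) (at t)"
      by (simp add: has_field_derivative_def matrix_vector_mult_scaleR mult_commute_abs)
    then show ?thesis unfolding p_def by (auto intro!: derivative_eq_intros)
  qed
  have "h \<bullet> (hessian f x *v h) \<le> L * (norm h)\<^sup>2" for x
  proof -
    have "0 \<le> h \<bullet> ((L *\<^sub>R mat 1 - hessian f x) *v h)" using H[of x] unfolding loewner_le_def by blast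
    also have "(L *\<^sub>R mat 1 - hessian f x) *v h = L *\<^sub>R h - hessian f x *v h"
      by (simp add: matrix_vector_mult_diff_rdistrib scaleR_matrix_vector_assoc[symmetric])
    finally show ?thesis by (simp add: inner_diff_right power2_norm_eq_inner)
  qed
  note hess_le = this
  have p: "p t \<le> p 0" if "0 \<le> t" for t
  proof (rule DERIV_nonpos_imp_nonincreasing[of 0 t p, OF that])
    fix x
    show "\<exists>y. (p has_real_derivative y) (at x) \<and> y \<le> 0"
      using dp[of x] hess_le[of "w + x *\<^sub>R h"]
      by (intro exI[of _ "h \<bullet> (hessian f (w + x *\<^sub>R h) *v h) - L * (norm h)\<^sup>2"]) simp
  qed
  \<comment> \<open>Chosen so that its derivative is \<open>p t - p 0\<close>; the claim is then
    \<open>q 1 \<le> q 0\<close>.\<close>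
  define q where "q t = f (w + t *\<^sub>R h) - t * p 0 - t\<^sup>2 * (L / 2 * (norm h)\<^sup>2)" for t
  have dq: "(q has_real_derivative (p t - p 0)) (at t)" for t
    unfolding q_def p_def
    by (auto intro!: derivative_eq_intros DERIV_along_line f)
  have "q 1 \<le> q 0"
  proof (rule DERIV_nonpos_imp_nonincreasing[of 0 1 q])
    fix x :: real assume "0 \<le> x"
    then show "\<exists>y. (q has_real_derivative y) (at x) \<and> y \<le> 0"
      using dq[of x] p[of x] by (intro exI[of _ "p x - p 0"]) simp
  qed simp
  then show ?thesis unfolding q_def p_def by simp
qed

section \<open>Differentiating an expectation\<close>

text \<open>The limit is taken along a sequence because countable limits preserve
  measurability.\<close>

lemma directional_LIMSEQ:
  fixes f :: "real^'n \<Rightarrow> real"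
  assumes "\<And>w. f differentiable (at w)"
  shows "(\<lambda>n. real (Suc n) * (f (w + (1 / real (Suc n)) *\<^sub>R h) - f w)) \<longlonglongrightarrow> h \<bullet> grad f w"
proof -
  have "((\<lambda>t. (f (w + t *\<^sub>R h) - f w) / t) \<longlongrightarrow> h \<bullet> grad f w) (at 0)"
    using DERIV_along_line[OF assms, where t = 0 and h = h and w = w] by (simp add: DERIV_def)
  moreover have "filterlim (\<lambda>n. 1 / real (Suc n)) (at 0) sequentially"
    using LIMSEQ_inverse_real_of_nat by (auto simp: filterlim_at inverse_eq_divide)
  ultimately have "((\<lambda>n. (f (w + (1 / real (Suc n)) *\<^sub>R h) - f w) / (1 / real (Suc n)))
      \<longlonglongrightarrow> h \<bullet> grad f w)"
    by (rule filterlim_compose)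
  then show ?thesis by (simp add: mult.commute)
qed

text \<open>With \<open>N\<close> the dimension, \<open>h\<close> is the average of the points
  \<open>N (h \<bullet> b) b\<close>, so Jensen's inequality reduces the claim to the axes. There
  \<open>R 0 = 0\<close> and convexity allow shrinking from \<open>s b\<close> or
  \<open>- s b\<close> by the factor \<open>N |h \<bullet> b| / s\<close>, which the smallness of
  \<open>h\<close> keeps below \<open>1\<close>. Both signs are summed so that the sign of the
  coordinate does not matter, and the weights \<open>1 / N\<close> cancel the factor
  \<open>N\<close>.\<close>

lemma convex_le_basis:
  fixes R :: "'a::euclidean_space \<Rightarrow> real"
  assumes conv: "convex_on UNIV R" and R0: "R 0 = 0" and R_nonneg: "\<And>x. 0 \<le> R x"
    and s: "0 < s" and h: "real DIM('a) * norm h \<le> s"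
  shows "R h \<le> norm h / s * (\<Sum>b\<in>Basis. R (s *\<^sub>R b) + R (- s *\<^sub>R b))"
proof -
  let ?N = "real DIM('a)"
  have shrink: "R (t *\<^sub>R x) \<le> t * R x" if "0 \<le> t" "t \<le> 1" for t x
    using convex_onD[OF conv, of t 0 x] that R0 by simp
  have one: "R ((?N * (h \<bullet> b)) *\<^sub>R b) \<le> ?N * norm h / s * (R (s *\<^sub>R b) + R (- s *\<^sub>R b))"
    if b: "b \<in> Basis" for b
  proof -
    define u where "u = ?N * (h \<bullet> b)"
    have u: "\<bar>u\<bar> \<le> ?N * norm h"
      unfolding u_def using Basis_le_norm[OF b, of h] by (simp add: abs_mult mult_left_mono)
    have us: "\<bar>u\<bar> / s \<le> 1" using u h s by simp
    have "R (u *\<^sub>R b) \<le> \<bar>u\<bar> / s * (R (s *\<^sub>R b) + R (- s *\<^sub>R b))"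
    proof (cases "0 \<le> u")
      case True
      have "R (u *\<^sub>R b) \<le> \<bar>u\<bar> / s * R (s *\<^sub>R b)"
        using shrink[OF divide_nonneg_pos[OF abs_ge_zero s] us, of "s *\<^sub>R b"] True s by simp
      also have "\<dots> \<le> \<bar>u\<bar> / s * (R (s *\<^sub>R b) + R (- s *\<^sub>R b))"
        using s R_nonneg by (intro mult_left_mono) auto
      finally show ?thesis .
    next
      case False
      have "R (u *\<^sub>R b) \<le> \<bar>u\<bar> / s * R (- s *\<^sub>R b)"
        using shrink[OF divide_nonneg_pos[OF abs_ge_zero s] us, of "- s *\<^sub>R b"] False s by simp
      also have "\<dots> \<le> \<bar>u\<bar> / s * (R (s *\<^sub>R b) + R (- s *\<^sub>R b))"
        using s R_nonneg by (intro mult_left_mono) auto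
      finally show ?thesis .
    qed
    also have "\<dots> \<le> ?N * norm h / s * (R (s *\<^sub>R b) + R (- s *\<^sub>R b))"
      using u s R_nonneg by (intro mult_right_mono divide_right_mono add_nonneg_nonneg) auto
    finally show ?thesis unfolding u_def .
  qed
  have "(\<Sum>b\<in>Basis. (1 / ?N) *\<^sub>R ((?N * (h \<bullet> b)) *\<^sub>R b)) = h"
    by (simp add: euclidean_representation)
  moreover have "R (\<Sum>b\<in>Basis. (1 / ?N) *\<^sub>R ((?N * (h \<bullet> b)) *\<^sub>R b))
      \<le> (\<Sum>b\<in>Basis. (1 / ?N) * R ((?N * (h \<bullet> b)) *\<^sub>R b))"
    by (rule convex_on_sum[OF _ _ conv]) auto
  ultimately have "R h \<le> (\<Sum>b\<in>Basis. (1 / ?N) * R ((?N * (h \<bullet> b)) *\<^sub>R b))" by simp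
  also have "\<dots> \<le> (\<Sum>b\<in>Basis. (1 / ?N) * (?N * norm h / s * (R (s *\<^sub>R b) + R (- s *\<^sub>R b))))"
    by (intro sum_mono mult_left_mono one) auto
  also have "\<dots> = norm h / s * (\<Sum>b\<in>Basis. R (s *\<^sub>R b) + R (- s *\<^sub>R b))"
    by (simp add: sum_distrib_left)
  finally show ?thesis .
qed

text \<open>The gap between the quadratic model at \<open>w\<close> and the function. Under the
  quadratic upper bound it is nonnegative and convex in \<open>h\<close>, although \<open>f\<close>
  itself need not be convex.\<close>

definition remainder :: "real \<Rightarrow> (real^'n \<Rightarrow> real) \<Rightarrow> real^'n \<Rightarrow> real^'n \<Rightarrow> real" where
  "remainder L f w h = f w + h \<bullet> grad f w + L / 2 * (norm h)\<^sup>2 - f (w + h)"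

text \<open>\<open>D\<close> is the gradient of the remainder at \<open>z\<close>, and the upper
  bound based at \<open>w + z\<close> says precisely that the remainder lies above its tangent
  there. Averaging the tangent inequality over the two end points cancels the linear terms, because
  \<open>z\<close> is their convex combination.\<close>

lemma convex_remainder:
  fixes f :: "real^'n \<Rightarrow> real"
  assumes Q: "\<And>w h. f (w + h) \<le> f w + h \<bullet> grad f w + L / 2 * (norm h)\<^sup>2"
  shows "convex_on UNIV (remainder L f w)"
proof (rule convex_onI)
  fix t :: real and x y :: "real^'n"
  assume t: "0 < t" "t < 1"
  define z where "z = (1 - t) *\<^sub>R x + t *\<^sub>R y"
  define D where "D = grad f w + L *\<^sub>R z - grad f (w + z)"
  have support: "remainder L f w z + (v - z) \<bullet> D \<le> remainder L f w v" for v
  proof -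
    have "f (w + v) \<le> f (w + z) + (v - z) \<bullet> grad f (w + z) + L / 2 * (norm (v - z))\<^sup>2"
      using Q[of "w + z" "v - z"] by simp
    moreover have "(norm (v - z))\<^sup>2 = (norm v)\<^sup>2 - (norm z)\<^sup>2 - 2 * ((v - z) \<bullet> z)"
      unfolding power2_norm_eq_inner by (simp add: inner_diff_left inner_diff_right inner_commute)
    ultimately show ?thesis
      unfolding remainder_def D_def inner_diff_left inner_diff_right inner_add_right inner_scaleR_right
      by (simp add: algebra_simps)
  qed
  have "(1 - t) * (remainder L f w z + (x - z) \<bullet> D) + t * (remainder L f w z + (y - z) \<bullet> D)
      \<le> (1 - t) * remainder L f w x + t * remainder L f w y"
    using t support by (intro add_mono mult_left_mono) auto
  moreover have "(1 - t) * (remainder L f w z + (x - z) \<bullet> D) + t * (remainder L f w z + (y - z) \<bullet> D)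
      = remainder L f w z + ((1 - t) *\<^sub>R x + t *\<^sub>R y - z) \<bullet> D"
    by (simp add: inner_diff_left inner_add_left algebra_simps)
  ultimately show "remainder L f w ((1 - t) *\<^sub>R x + t *\<^sub>R y)
      \<le> (1 - t) * remainder L f w x + t * remainder L f w y"
    by (simp add: z_def)
qed simp

text \<open>Along a fixed direction the remainder is of smaller order than the step; this is the
  pointwise convergence needed under the integral.\<close>

lemma remainder_LIMSEQ:
  fixes f :: "real^'n \<Rightarrow> real"
  assumes "\<And>w. f differentiable (at w)"
  shows "(\<lambda>n. real (Suc n) * remainder L f w ((1 / real (Suc n)) *\<^sub>R h)) \<longlonglongrightarrow> 0"
proof -
  have "(\<lambda>n. h \<bullet> grad f w + L / 2 * (norm h)\<^sup>2 * inverse (real (Suc n))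
      - real (Suc n) * (f (w + (1 / real (Suc n)) *\<^sub>R h) - f w))
      \<longlonglongrightarrow> h \<bullet> grad f w + L / 2 * (norm h)\<^sup>2 * 0 - h \<bullet> grad f w"
    by (intro tendsto_intros LIMSEQ_inverse_real_of_nat directional_LIMSEQ assms)
  moreover have "real (Suc n) * remainder L f w ((1 / real (Suc n)) *\<^sub>R h) =
      h \<bullet> grad f w + L / 2 * (norm h)\<^sup>2 * inverse (real (Suc n))
      - real (Suc n) * (f (w + (1 / real (Suc n)) *\<^sub>R h) - f w)" for n
  proof -
    have "k * remainder L f w ((1 / k) *\<^sub>R h) =
        h \<bullet> grad f w + L / 2 * (norm h)\<^sup>2 * inverse k - k * (f (w + (1 / k) *\<^sub>R h) - f w)"
      if "k > 0" for k :: real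
      using that unfolding remainder_def by (simp add: field_simps power2_eq_square)
    from this[of "real (Suc n)"] show ?thesis by simp
  qed
  ultimately show ?thesis by simp
qed

text \<open>The remainder of the second-order upper bound is convex and nonnegative, so near \<open>0\<close> it is
  controlled by its values at the points \<open>\<plusminus>s b\<close> with \<open>b\<close> in the basis. This reduces Frechet
  differentiability of the expectation to dominated convergence along finitely many directions.\<close>

lemma expectation_quadratic_upper_bound:
  fixes \<Phi> :: "real^'n \<Rightarrow> 'w \<Rightarrow> real"
  assumes "prob_space M"
    and diff: "\<And>\<omega> w. \<omega> \<in> space M \<Longrightarrow> (\<lambda>w. \<Phi> w \<omega>) differentiable (at w)"
    and Q: "\<And>\<omega> w h. \<omega> \<in> space M \<Longrightarrow>
      \<Phi> (w + h) \<omega> \<le> \<Phi> w \<omega> + h \<bullet> grad (\<lambda>w. \<Phi> w \<omega>) w + L / 2 * (norm h)\<^sup>2"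
    and int: "\<And>w. integrable M (\<Phi> w)"
    and f: "\<And>w. f w = integral\<^sup>L M (\<Phi> w)"
  shows "f differentiable (at w)"
    and "f (w + h) \<le> f w + h \<bullet> grad f w + L / 2 * (norm h)\<^sup>2"
proof -
  interpret prob_space M by fact
  define G where "G w \<omega> = grad (\<lambda>w. \<Phi> w \<omega>) w" for w \<omega>
  have [measurable]: "\<Phi> w \<in> borel_measurable M" for w using int by blast
  have [measurable]: "(\<lambda>\<omega>. h \<bullet> G w \<omega>) \<in> borel_measurable M" for w h
  proof (rule borel_measurable_LIMSEQ_real)
    show "(\<lambda>n. real (Suc n) * (\<Phi> (w + (1 / real (Suc n)) *\<^sub>R h) \<omega> - \<Phi> w \<omega>)) \<longlonglongrightarrow> h \<bullet> G w \<omega>"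
      if "\<omega> \<in> space M" for \<omega>
      unfolding G_def by (rule directional_LIMSEQ) (rule diff[OF that])
  qed measurable
  \<comment> \<open>The upper bound in the directions \<open>h\<close> and \<open>- h\<close>
    encloses \<open>h \<bullet> G w \<omega>\<close> between integrable expressions.\<close>
  have intG: "integrable M (\<lambda>\<omega>. h \<bullet> G w \<omega>)" for w h
  proof (rule Bochner_Integration.integrable_bound)
    show "integrable M (\<lambda>\<omega>. \<bar>\<Phi> (w + h) \<omega>\<bar> + \<bar>\<Phi> w \<omega>\<bar> + \<bar>\<Phi> (w - h) \<omega>\<bar> + \<bar>L / 2 * (norm h)\<^sup>2\<bar>)"
      using int by auto
    have "\<bar>h \<bullet> G w \<omega>\<bar> \<le> \<bar>\<Phi> (w + h) \<omega>\<bar> + \<bar>\<Phi> w \<omega>\<bar> + \<bar>\<Phi> (w - h) \<omega>\<bar> + \<bar>L / 2 * (norm h)\<^sup>2\<bar>"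
      if "\<omega> \<in> space M" for \<omega>
      using Q[OF that, of w h] Q[OF that, of w "- h"] unfolding G_def by (simp add: abs_le_iff) linarith
    then show "AE \<omega> in M. norm (h \<bullet> G w \<omega>)
        \<le> norm (\<bar>\<Phi> (w + h) \<omega>\<bar> + \<bar>\<Phi> w \<omega>\<bar> + \<bar>\<Phi> (w - h) \<omega>\<bar> + \<bar>L / 2 * (norm h)\<^sup>2\<bar>)"
      by (auto intro!: AE_I2 simp del: abs_mult)
  qed measurable
  \<comment> \<open>The candidate gradient of \<open>f\<close>: the expectation of the gradients,
    taken coordinate by coordinate.\<close>
  define D where "D w = (\<chi> i. \<integral>\<omega>. axis i 1 \<bullet> G w \<omega> \<partial>M)" for w
  have ED: "(\<integral>\<omega>. h \<bullet> G w \<omega> \<partial>M) = h \<bullet> D w" for h w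
  proof -
    have expand: "h \<bullet> v = (\<Sum>i\<in>UNIV. h $ i * (axis i 1 \<bullet> v))" for v :: "real^'n"
      unfolding inner_axis' by (simp add: inner_vec_def)
    have "(\<integral>\<omega>. h \<bullet> G w \<omega> \<partial>M) = (\<Sum>i\<in>UNIV. h $ i * (\<integral>\<omega>. axis i 1 \<bullet> G w \<omega> \<partial>M))"
      unfolding expand[of "G w _"] using intG by simp
    also have "\<dots> = h \<bullet> D w" by (simp add: D_def inner_vec_def)
    finally show ?thesis .
  qed
  have Qf: "f (w + h) \<le> f w + h \<bullet> D w + L / 2 * (norm h)\<^sup>2" for w h
  proof -
    have "f (w + h) \<le> (\<integral>\<omega>. \<Phi> w \<omega> + h \<bullet> G w \<omega> + L / 2 * (norm h)\<^sup>2 \<partial>M)"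
      unfolding f using Q int intG by (intro integral_mono) (auto simp: G_def)
    also have "\<dots> = f w + h \<bullet> D w + L / 2 * (norm h)\<^sup>2"
      using int intG by (simp add: ED f prob_space)
    finally show ?thesis .
  qed
  have der: "(f has_derivative (\<lambda>h. h \<bullet> D w)) (at w)" for w
    unfolding has_derivative_at_alt
  proof (intro conjI allI impI)
    show "bounded_linear (\<lambda>h. h \<bullet> D w)" by (rule bounded_linear_inner_left)
    fix e :: real assume e: "0 < e"
    define R where "R h \<omega> = remainder L (\<lambda>w. \<Phi> w \<omega>) w h" for h \<omega>
    have R_eq: "R h \<omega> = \<Phi> w \<omega> + h \<bullet> G w \<omega> + L / 2 * (norm h)\<^sup>2 - \<Phi> (w + h) \<omega>" for h \<omega>
      unfolding R_def remainder_def G_def ..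
    have conv: "convex_on UNIV (\<lambda>h. R h \<omega>)" if "\<omega> \<in> space M" for \<omega>
      unfolding R_def using convex_remainder[OF Q[OF that]] by simp
    have R0: "R 0 \<omega> = 0" for \<omega> by (simp add: R_eq)
    have Rpos: "0 \<le> R h \<omega>" if "\<omega> \<in> space M" for h \<omega>
      using Q[OF that] by (simp add: R_eq G_def)
    have intR: "integrable M (R h)" for h unfolding R_eq using int intG by simp
    have ER: "(\<integral>\<omega>. R h \<omega> \<partial>M) = f w + h \<bullet> D w + L / 2 * (norm h)\<^sup>2 - f (w + h)" for h
      unfolding R_eq using int intG by (simp add: ED f prob_space)
    define m where "m s \<omega> = (\<Sum>b\<in>Basis. R (s *\<^sub>R b) \<omega> + R (- s *\<^sub>R b) \<omega>)" for s \<omega>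
    have intm: "integrable M (m s)" for s unfolding m_def using intR by simp
    have mpos: "0 \<le> m s \<omega>" if "\<omega> \<in> space M" for s \<omega>
      unfolding m_def using Rpos[OF that] by (simp add: sum_nonneg)
    have "(\<lambda>n. \<integral>\<omega>. real (Suc n) * m (1 / real (Suc n)) \<omega> \<partial>M) \<longlonglongrightarrow> (\<integral>\<omega>. 0 \<partial>M)"
    proof (rule integral_dominated_convergence[where w = "m 1"])
      have "(\<lambda>n. real (Suc n) * m (1 / real (Suc n)) \<omega>) \<longlonglongrightarrow> 0" if "\<omega> \<in> space M" for \<omega>
      proof -
        have "(\<lambda>n. \<Sum>b\<in>Basis. real (Suc n) * R ((1 / real (Suc n)) *\<^sub>R b) \<omega>
            + real (Suc n) * R ((1 / real (Suc n)) *\<^sub>R (- b)) \<omega>) \<longlonglongrightarrow> (\<Sum>b\<in>(Basis :: (real^'n) set). 0 + 0)"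
          unfolding R_def by (intro tendsto_sum tendsto_add remainder_LIMSEQ diff that)
        then show ?thesis by (simp add: m_def sum_distrib_left distrib_left)
      qed
      then show "AE \<omega> in M. (\<lambda>n. real (Suc n) * m (1 / real (Suc n)) \<omega>) \<longlonglongrightarrow> 0" by simp
      fix n
      \<comment> \<open>Convexity and \<open>R 0 = 0\<close> make \<open>k R (x / k)\<close> at most
        \<open>R x\<close>, so the rescaled sums are dominated by the integrable
        \<open>m 1\<close>.\<close>
      have shrink: "k * R ((1 / k) *\<^sub>R x) \<omega> \<le> R x \<omega>" if "\<omega> \<in> space M" "1 \<le> k" for x \<omega> k
      proof -
        have "R ((1 / k) *\<^sub>R x) \<omega> \<le> (1 / k) * R x \<omega>"
          using convex_onD[OF conv[OF that(1)], of "1 / k" 0 x] that(2) by (simp add: R0)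
        then show ?thesis using that(2) by (simp add: field_simps)
      qed
      have "real (Suc n) * m (1 / real (Suc n)) \<omega> \<le> m 1 \<omega>" if "\<omega> \<in> space M" for \<omega>
        unfolding m_def sum_distrib_left distrib_left
        using shrink[OF that, of "real (Suc n)"] shrink[OF that, of "real (Suc n)" "- _"]
        by (intro sum_mono add_mono) auto
      then show "AE \<omega> in M. norm (real (Suc n) * m (1 / real (Suc n)) \<omega>) \<le> m 1 \<omega>"
        using mpos by auto
    qed (use intm in \<open>auto\<close>)
    then have "(\<lambda>n. real (Suc n) * (\<integral>\<omega>. m (1 / real (Suc n)) \<omega> \<partial>M)) \<longlonglongrightarrow> 0" by simp
    then have "\<forall>\<^sub>F n in sequentially. real (Suc n) * (\<integral>\<omega>. m (1 / real (Suc n)) \<omega> \<partial>M) < e / 2"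
      using e by (intro order_tendstoD(2)[of _ 0]) auto
    then obtain n where n: "real (Suc n) * (\<integral>\<omega>. m (1 / real (Suc n)) \<omega> \<partial>M) < e / 2"
      by (auto simp: eventually_sequentially)
    define s where "s = 1 / real (Suc n)"
    have s: "s > 0" "(\<integral>\<omega>. m s \<omega> \<partial>M) / s < e / 2" using n by (auto simp: s_def mult.commute)
    let ?N = "real DIM(real^'n)"
    \<comment> \<open>Half of \<open>e\<close> pays for the expected remainder and half for the
      quadratic term. The first radius brings \<open>h\<close> into the range of
      \<open>convex_le_basis\<close>, the second gives \<open>|L| * norm h \<le> e\<close>.\<close>
    have "\<bar>f y - f w - (y - w) \<bullet> D w\<bar> \<le> e * norm (y - w)"
      if y: "norm (y - w) < min (s / ?N) (e / (\<bar>L\<bar> + 1))" for y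
    proof -
      define h where "h = y - w"
      have "(\<integral>\<omega>. R h \<omega> \<partial>M) \<le> (\<integral>\<omega>. norm h / s * m s \<omega> \<partial>M)"
      proof (rule integral_mono)
        fix \<omega> assume \<omega>: "\<omega> \<in> space M"
        have "?N * norm h \<le> s" using y unfolding h_def by (simp add: field_simps)
        then show "R h \<omega> \<le> norm h / s * m s \<omega>"
          unfolding m_def using conv[OF \<omega>] R0 Rpos[OF \<omega>] s by (intro convex_le_basis) auto
      qed (use intR intm in auto)
      also have "\<dots> = norm h * ((\<integral>\<omega>. m s \<omega> \<partial>M) / s)" by simp
      also have "\<dots> \<le> norm h * (e / 2)" using s by (intro mult_left_mono) auto
      finally have up: "(\<integral>\<omega>. R h \<omega> \<partial>M) \<le> norm h * (e / 2)" .
      have lo: "0 \<le> (\<integral>\<omega>. R h \<omega> \<partial>M)" using Rpos by (intro integral_nonneg_AE) auto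
      have "\<bar>L\<bar> * norm h \<le> (\<bar>L\<bar> + 1) * norm h" by (intro mult_right_mono) auto
      also have "\<dots> \<le> e" using y unfolding h_def by (simp add: field_simps)
      finally have "(\<bar>L\<bar> * norm h) * norm h \<le> e * norm h" by (intro mult_right_mono) auto
      then have "\<bar>L / 2 * (norm h)\<^sup>2\<bar> \<le> e / 2 * norm h" by (simp add: abs_mult power2_eq_square)
      moreover have "f y - f w - (y - w) \<bullet> D w = L / 2 * (norm h)\<^sup>2 - (\<integral>\<omega>. R h \<omega> \<partial>M)"
        unfolding ER h_def by simp
      moreover have "norm h * (e / 2) + e / 2 * norm h = e * norm h" by simp
      ultimately show ?thesis using up lo unfolding h_def[symmetric] by linarith
    qed
    moreover have "min (s / ?N) (e / (\<bar>L\<bar> + 1)) > 0" using s e by simp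
    ultimately show "\<exists>d>0. \<forall>y. norm (y - w) < d \<longrightarrow>
        norm (f y - f w - (y - w) \<bullet> D w) \<le> e * norm (y - w)"
      unfolding real_norm_def by blast
  qed
  then show "f differentiable (at w)" unfolding differentiable_def by blast
  have "grad f w = D w" using der by (intro grad_eqI) (simp add: gderiv_def)
  then show "f (w + h) \<le> f w + h \<bullet> grad f w + L / 2 * (norm h)\<^sup>2" using Qf by simp
qed

section \<open>Subsampled functions, their Hessians, and the expected objective\<close>

lemma twice_cont_diff_imp_differentiable:
  assumes "twice_cont_diff f"
  shows "f differentiable (at w)" "grad f differentiable (at w)"
  using assms unfolding twice_cont_diff_def by auto

lemma subsampled_twice_differentiable:
  fixes F :: "real^'n \<Rightarrow> 'z \<Rightarrow> real"
  assumes C2: "\<And>i. i \<in> S \<Longrightarrow> twice_cont_diff (\<lambda>w. F w (\<zeta> i \<omega>))"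
  shows "subsampled F \<zeta> S \<omega> differentiable (at w)"
    and "grad (subsampled F \<zeta> S \<omega>) differentiable (at w)"
proof -
  define G where "G w = (1 / real (card S)) *\<^sub>R (\<Sum>i\<in>S. grad (\<lambda>w. F w (\<zeta> i \<omega>)) w)" for w
  have der: "(subsampled F \<zeta> S \<omega> has_derivative (\<lambda>h. h \<bullet> G w)) (at w)" for w
  proof -
    have "((\<lambda>w. (1 / real (card S)) * (\<Sum>i\<in>S. F w (\<zeta> i \<omega>))) has_derivative
        (\<lambda>h. (1 / real (card S)) * (\<Sum>i\<in>S. h \<bullet> grad (\<lambda>w. F w (\<zeta> i \<omega>)) w))) (at w)"
      using twice_cont_diff_imp_differentiable(1)[OF C2]
      by (intro has_derivative_mult_right has_derivative_sum has_derivative_grad) auto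
    then show ?thesis by (simp add: subsampled_def[abs_def] G_def inner_sum_right)
  qed
  then show "subsampled F \<zeta> S \<omega> differentiable (at w)" unfolding differentiable_def by blast
  have "grad (subsampled F \<zeta> S \<omega>) = G"
    using der by (intro ext grad_eqI) (simp add: gderiv_def)
  moreover have "G differentiable (at w)"
  proof (cases "finite S")
    case True
    then show ?thesis unfolding G_def[abs_def]
      using twice_cont_diff_imp_differentiable(2)[OF C2]
      by (intro differentiable_scaleR differentiable_sum) auto
  qed (simp add: G_def[abs_def])
  ultimately show "grad (subsampled F \<zeta> S \<omega>) differentiable (at w)" by simp
qed

text \<open>Symmetry puts the averaged Hessian among the matrices for which \<open>mat_abs\<close>
  has a decomposition to choose.\<close>

lemma averaged_hessian_symmetric:
  fixes F :: "real^'n \<Rightarrow> 'z \<Rightarrow> real"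
  assumes "\<And>i. twice_cont_diff (\<lambda>w. F w (\<zeta> i \<omega>))"
  shows "transpose (averaged_hessian F \<zeta> S \<gamma> w k \<omega>) = averaged_hessian F \<zeta> S \<gamma> w k \<omega>"
proof -
  have "transpose (hessian (subsampled F \<zeta> T \<omega>) x) = hessian (subsampled F \<zeta> T \<omega>) x" for T x
    using subsampled_twice_differentiable[of T F \<zeta> \<omega>] assms by (intro hessian_symmetric) auto
  then have "transpose (hessian (subsampled F \<zeta> T \<omega>) x) $ i $ j = hessian (subsampled F \<zeta> T \<omega>) x $ i $ j"
    for T x i j by simp
  then have "hessian (subsampled F \<zeta> T \<omega>) x $ j $ i = hessian (subsampled F \<zeta> T \<omega>) x $ i $ j" for T x i j
    by (simp add: transpose_def)
  then have "averaged_hessian F \<zeta> S \<gamma> w k \<omega> $ j $ i = averaged_hessian F \<zeta> S \<gamma> w k \<omega> $ i $ j" for i j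
    unfolding averaged_hessian_def sum_component vector_scaleR_component
    by (intro sum.cong arg_cong2[of _ _ _ _ scaleR] refl)
  then show ?thesis by (simp add: transpose_def vec_eq_iff)
qed

text \<open>For the sample set \<open>{0}\<close> the subsampled function is \<open>F\<close> at the
  sample \<open>\<zeta> 0\<close>, whose distribution is \<open>Z\<close>. Thus \<open>f\<close> is
  an expectation of functions that each satisfy the quadratic upper bound with the constant for
  sample size one, which is at most \<open>L\<close>.\<close>

lemma expected_objective_quadratic_upper_bound:
  fixes F :: "real^'n \<Rightarrow> 'z \<Rightarrow> real"
  assumes M: "prob_space M" and \<zeta>: "\<zeta> 0 \<in> M \<rightarrow>\<^sub>M Z" "distr M Z (\<zeta> 0) = Z"
    and C2: "\<And>z. z \<in> space Z \<Longrightarrow> twice_cont_diff (\<lambda>w. F w z)"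
    and f: "\<And>w. integrable Z (F w)" "\<And>w. f w = integral\<^sup>L Z (F w)"
    and spectral: "spectral_upper_bound (space M) F \<zeta> L"
  shows "f differentiable (at w)"
    and "f (w + h) \<le> f w + h \<bullet> grad f w + L / 2 * (norm h)\<^sup>2"
    and "0 < L"
proof -
  obtain L1 where L1: "0 < L1" "L1 \<le> L" and
    hess: "\<And>S \<omega> w. finite S \<Longrightarrow> card S = 1 \<Longrightarrow> \<omega> \<in> space M \<Longrightarrow>
      loewner_le (hessian (subsampled F \<zeta> S \<omega>) w) (L1 *\<^sub>R mat 1)"
    using spectral unfolding spectral_upper_bound_def by (metis le_refl)
  have sub: "subsampled F \<zeta> {0} \<omega> = (\<lambda>w. F w (\<zeta> 0 \<omega>))" for \<omega> by (simp add: subsampled_def[abs_def])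
  have z: "\<zeta> 0 \<omega> \<in> space Z" if "\<omega> \<in> space M" for \<omega> using \<zeta>(1) that by (rule measurable_space)
  have int: "integrable M (\<lambda>\<omega>. F w (\<zeta> 0 \<omega>))" for w
    using f(1)[of w] \<zeta> integrable_distr[of "\<zeta> 0" M Z "F w"] by simp
  have feq: "f w = (\<integral>\<omega>. F w (\<zeta> 0 \<omega>) \<partial>M)" for w
  proof -
    have "f w = integral\<^sup>L (distr M Z (\<zeta> 0)) (F w)" using f(2) \<zeta>(2) by simp
    also have "\<dots> = (\<integral>\<omega>. F w (\<zeta> 0 \<omega>) \<partial>M)" using \<zeta>(1) f(1)[of w] by (intro integral_distr) auto
    finally show ?thesis .
  qed
  have diff: "(\<lambda>w. F w (\<zeta> 0 \<omega>)) differentiable (at w)" if "\<omega> \<in> space M" for \<omega> w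
    by (rule twice_cont_diff_imp_differentiable[OF C2[OF z[OF that]]])
  have Q: "F (w + h) (\<zeta> 0 \<omega>) \<le> F w (\<zeta> 0 \<omega>) + h \<bullet> grad (\<lambda>w. F w (\<zeta> 0 \<omega>)) w + L1 / 2 * (norm h)\<^sup>2"
    if "\<omega> \<in> space M" for \<omega> w h
    using hess[of "{0}", OF _ _ that, unfolded sub]
    by (intro quadratic_upper_bound diff[OF that] twice_cont_diff_imp_differentiable[OF C2[OF z[OF that]]]) auto
  note exp = expectation_quadratic_upper_bound[where \<Phi> = "\<lambda>w \<omega>. F w (\<zeta> 0 \<omega>)", OF M diff Q int feq]
  show "f differentiable (at w)" by (rule exp(1))
  have "L1 / 2 * (norm h)\<^sup>2 \<le> L / 2 * (norm h)\<^sup>2" using L1 by (intro mult_right_mono) auto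
  with exp(2)[of w h] show "f (w + h) \<le> f w + h \<bullet> grad f w + L / 2 * (norm h)\<^sup>2" by linarith
  show "0 < L" using L1 by linarith
qed

section \<open>Measurability and conditional expectations\<close>

lemma borel_measurable_nth_vec:
  fixes x :: "'w \<Rightarrow> real^'n"
  assumes [measurable]: "x \<in> borel_measurable N"
  shows "(\<lambda>\<omega>. x \<omega> $ i) \<in> borel_measurable N"
proof -
  have "(\<lambda>\<omega>. x \<omega> \<bullet> axis i 1) \<in> borel_measurable N" by measurable
  then show ?thesis by (simp add: inner_axis)
qed

lemma borel_measurable_nth_matrix:
  fixes A :: "'w \<Rightarrow> real^'n^'m"
  assumes [measurable]: "A \<in> borel_measurable N"
  shows "(\<lambda>\<omega>. A \<omega> $ i $ j) \<in> borel_measurable N"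
proof -
  have "(\<lambda>\<omega>. A \<omega> \<bullet> axis i (axis j 1)) \<in> borel_measurable N" by measurable
  then show ?thesis by (simp add: inner_axis)
qed

lemma borel_measurable_vecI:
  fixes x :: "'w \<Rightarrow> real^'n"
  assumes "\<And>i. (\<lambda>\<omega>. x \<omega> $ i) \<in> borel_measurable N"
  shows "x \<in> borel_measurable N"
  unfolding borel_measurable_euclidean_space[of x]
  using assms by (auto simp: Basis_vec_def inner_axis)

lemma borel_measurable_det:
  fixes A :: "'w \<Rightarrow> real^'n^'n"
  assumes "\<And>i j. (\<lambda>\<omega>. A \<omega> $ i $ j) \<in> borel_measurable N"
  shows "(\<lambda>\<omega>. det (A \<omega>)) \<in> borel_measurable N"
  unfolding det_def using assms by (intro borel_measurable_sum borel_measurable_times borel_measurable_prod) auto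

text \<open>\<open>matrix_inv\<close> is a choice operator with no evident measurability; Cramer's
  rule expresses the solution of the linear system by determinants, which are polynomials in the
  entries. \<open>N\<close> is arbitrary because the sigma-algebra of the past has to be covered
  too.\<close>

lemma borel_measurable_matrix_inv_mult:
  fixes H :: "'w \<Rightarrow> real^'n^'n"
  assumes [measurable]: "H \<in> borel_measurable N" "x \<in> borel_measurable N"
    and H: "\<And>\<omega>. \<omega> \<in> space N \<Longrightarrow> det (H \<omega>) \<noteq> 0"
      "\<And>\<omega> v. \<omega> \<in> space N \<Longrightarrow> H \<omega> *v (matrix_inv (H \<omega>) *v v) = v"
  shows "(\<lambda>\<omega>. matrix_inv (H \<omega>) *v x \<omega>) \<in> borel_measurable N"
proof (rule borel_measurable_vecI)
  fix k
  note [measurable] = borel_measurable_nth_vec[of x] borel_measurable_nth_matrix[of H]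
  have "(\<lambda>\<omega>. det (\<chi> i j. if j = k then x \<omega> $ i else H \<omega> $ i $ j) / det (H \<omega>)) \<in> borel_measurable N"
    by (intro borel_measurable_divide borel_measurable_det) (auto split: if_split)
  moreover have "(matrix_inv (H \<omega>) *v x \<omega>) $ k =
      det (\<chi> i j. if j = k then x \<omega> $ i else H \<omega> $ i $ j) / det (H \<omega>)" if "\<omega> \<in> space N" for \<omega>
    using iffD1[OF cramer[OF H(1)[OF that]] H(2)[OF that]] by simp
  ultimately show "(\<lambda>\<omega>. (matrix_inv (H \<omega>) *v x \<omega>) $ k) \<in> borel_measurable N"
    by (simp cong: measurable_cong)
qed

text \<open>The gradient of a differentiable function can be discontinuous; it is measurable as a
  limit of difference quotients, which are continuous in \<open>w\<close>.\<close>

lemma borel_measurable_grad: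
  fixes f :: "real^'n \<Rightarrow> real"
  assumes f: "\<And>w. f differentiable (at w)"
  shows "grad f \<in> borel_measurable borel"
proof (rule borel_measurable_vecI)
  fix i
  have "continuous_on UNIV f"
    using f by (simp add: continuous_on_eq_continuous_within differentiable_imp_continuous_within)
  then have [measurable]: "f \<in> borel_measurable borel" by (rule borel_measurable_continuous_onI)
  have "(\<lambda>w. axis i 1 \<bullet> grad f w) \<in> borel_measurable borel"
    by (rule borel_measurable_LIMSEQ_real[OF directional_LIMSEQ[OF f]]) measurable
  then show "(\<lambda>w. grad f w $ i) \<in> borel_measurable borel" by (simp add: inner_axis')
qed

section \<open>The sigma-algebras of the history\<close>

lemma events_of_subset:
  assumes "X \<in> borel_measurable M"
  shows "events_of M X \<subseteq> sets M"
  using assms unfolding events_of_def by (auto simp: sets_vimage_algebra2 dest: measurable_sets)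

lemma sample_events_subset:
  assumes T: "T \<in> M \<rightarrow>\<^sub>M count_space {T. finite T \<and> T \<noteq> {}}" and [measurable]: "\<And>i. \<zeta> i \<in> M \<rightarrow>\<^sub>M Z"
  shows "sample_events M Z \<zeta> T \<subseteq> sets M"
  unfolding sample_events_def
proof (rule sets.sigma_sets_subset, safe)
  fix i :: nat and B assume [measurable]: "B \<in> sets Z"
  have "T -` {T. finite T \<and> T \<noteq> {} \<and> i \<in> T} \<inter> space M \<in> sets M"
    using T by (rule measurable_sets) auto
  moreover have "\<zeta> i -` B \<inter> space M \<in> sets M" by measurable
  ultimately have "(T -` {T. finite T \<and> T \<noteq> {} \<and> i \<in> T} \<inter> space M) \<inter> (\<zeta> i -` B \<inter> space M) \<in> sets M"
    by (rule sets.Int)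
  also have "(T -` {T. finite T \<and> T \<noteq> {} \<and> i \<in> T} \<inter> space M) \<inter> (\<zeta> i -` B \<inter> space M)
      = {\<omega> \<in> space M. i \<in> T \<omega> \<and> \<zeta> i \<omega> \<in> B}"
    using measurable_space[OF T] by auto
  finally show "{\<omega> \<in> space M. i \<in> T \<omega> \<and> \<zeta> i \<omega> \<in> B} \<in> sets M" .
qed

lemma subalgebra_past:
  fixes w :: "nat \<Rightarrow> 'w \<Rightarrow> real^'n"
  assumes "\<And>k. w k \<in> borel_measurable M" "\<And>k. g k \<in> borel_measurable M" "\<And>k. H k \<in> borel_measurable M"
    and "\<And>k. S k \<in> M \<rightarrow>\<^sub>M count_space {T. finite T \<and> T \<noteq> {}}" and "\<And>i. \<zeta> i \<in> M \<rightarrow>\<^sub>M Z"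
  shows "subalgebra M (past M Z \<zeta> S H g w k)" and "w k \<in> borel_measurable (past M Z \<zeta> S H g w k)"
proof -
  let ?E = "(\<Union>j\<le>k. events_of M (w j)) \<union>
      (\<Union>j<k. events_of M (g j) \<union> events_of M (H j) \<union> sample_events M Z \<zeta> (S j))"
  have E: "?E \<subseteq> sets M"
    by (intro Un_least UN_least events_of_subset sample_events_subset assms)
  then have E': "?E \<subseteq> Pow (space M)" using sets.sets_into_space by blast
  show "subalgebra M (past M Z \<zeta> S H g w k)"
    unfolding subalgebra_def past_def using E E' by (simp add: sets.sigma_sets_subset)
  show "w k \<in> borel_measurable (past M Z \<zeta> S H g w k)"
  proof (rule measurableI)
    fix B :: "(real^'n) set" assume "B \<in> sets borel"
    then have "w k -` B \<inter> space M \<in> events_of M (w k)"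
      unfolding events_of_def by (auto simp: sets_vimage_algebra2)
    then show "w k -` B \<inter> space (past M Z \<zeta> S H g w k) \<in> sets (past M Z \<zeta> S H g w k)"
      unfolding past_def using E' by (auto intro!: sigma_sets.Basic)
  qed simp
qed

lemma subalgebra_past_with:
  fixes X :: "'w \<Rightarrow> 'b::topological_space" and Y :: "'w \<Rightarrow> 'c::topological_space"
  assumes G: "subalgebra M G" and X: "X \<in> borel_measurable M"
  shows "subalgebra M (past_with M G X)" and "X \<in> borel_measurable (past_with M G X)"
    and "Y \<in> borel_measurable G \<Longrightarrow> Y \<in> borel_measurable (past_with M G X)"
proof -
  have E: "sets G \<union> events_of M X \<subseteq> sets M"
    using events_of_subset[OF X] G unfolding subalgebra_def by blast
  then have E': "sets G \<union> events_of M X \<subseteq> Pow (space M)" using sets.sets_into_space by blast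
  show "subalgebra M (past_with M G X)"
    unfolding subalgebra_def past_with_def using E E' by (simp add: sets.sigma_sets_subset)
  show "X \<in> borel_measurable (past_with M G X)"
  proof (rule measurableI)
    fix B :: "'b set" assume "B \<in> sets borel"
    then have "X -` B \<inter> space M \<in> events_of M X"
      unfolding events_of_def by (auto simp: sets_vimage_algebra2)
    then show "X -` B \<inter> space (past_with M G X) \<in> sets (past_with M G X)"
      unfolding past_with_def using E' by (auto intro!: sigma_sets.Basic)
  qed simp
  assume Y: "Y \<in> borel_measurable G"
  show "Y \<in> borel_measurable (past_with M G X)"
  proof (rule measurableI)
    fix B :: "'c set" assume "B \<in> sets borel"
    then have "Y -` B \<inter> space G \<in> sets G" using Y by (rule measurable_sets[rotated])
    then have "Y -` B \<inter> space M \<in> sets G" using G unfolding subalgebra_def by simp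
    then show "Y -` B \<inter> space (past_with M G X) \<in> sets (past_with M G X)"
      unfolding past_with_def using E' by (auto intro!: sigma_sets.Basic)
  qed simp
qed

section \<open>From conditional hypotheses to expectations\<close>

lemma mnorm_power2: "0 \<le> v \<bullet> (A *v v) \<Longrightarrow> (mnorm A v)\<^sup>2 = v \<bullet> (A *v v)"
  by (simp add: mnorm_def)

text \<open>The tower property, with the constant test function \<open>1\<close>, is carried out in
  \<open>[0, \<infinity>]\<close>; integrability of the squared error therefore comes out as a
  conclusion. \<open>E\<close> and \<open>N\<close> stand for the squared norms in whichever form
  suits the metric: quadratic forms in \<open>P\<close> or Euclidean squares.\<close>

lemma stoch_norm_cond_expectation:
  assumes "prob_space M" and sub: "subalgebra M (past_with M G A)"
    and cond: "stoch_norm_cond M G A g v \<theta> \<iota>" and \<iota>: "0 \<le> \<iota>"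
    and E: "\<And>\<omega>. \<omega> \<in> space M \<Longrightarrow> (mnorm (A \<omega>) (g \<omega> - v \<omega>))\<^sup>2 = E \<omega>" "E \<in> borel_measurable M"
    and N: "\<And>\<omega>. \<omega> \<in> space M \<Longrightarrow> (mnorm (A \<omega>) (v \<omega>))\<^sup>2 = N \<omega>" "integrable M N"
  shows "integrable M E" and "(\<integral>\<omega>. E \<omega> \<partial>M) \<le> \<theta>\<^sup>2 * (\<integral>\<omega>. N \<omega> \<partial>M) + \<iota>"
proof -
  interpret prob_space M by fact
  interpret finite_measure_subalgebra M "past_with M G A"
    by unfold_locales (rule sub)
  have E_nonneg: "0 \<le> E \<omega>" if "\<omega> \<in> space M" for \<omega> using E(1)[OF that] by (metis zero_le_power2)
  have N_nonneg: "0 \<le> N \<omega>" if "\<omega> \<in> space M" for \<omega> using N(1)[OF that] by (metis zero_le_power2)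
  define e where "e \<omega> = ennreal ((mnorm (A \<omega>) (g \<omega> - v \<omega>))\<^sup>2)" for \<omega>
  have e_eq: "e \<omega> = ennreal (E \<omega>)" if "\<omega> \<in> space M" for \<omega> unfolding e_def using E(1)[OF that] by simp
  have [measurable]: "E \<in> borel_measurable M" by (rule E(2))
  have e_meas: "e \<in> borel_measurable M"
    using e_eq by (subst measurable_cong[where g = "\<lambda>\<omega>. ennreal (E \<omega>)"]) auto
  have "(\<integral>\<^sup>+\<omega>. ennreal (E \<omega>) \<partial>M) = (\<integral>\<^sup>+\<omega>. 1 * e \<omega> \<partial>M)"
    using e_eq by (intro nn_integral_cong) simp
  also have "\<dots> = (\<integral>\<^sup>+\<omega>. 1 * nn_cond_exp M (past_with M G A) e \<omega> \<partial>M)"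
    using e_meas by (intro nn_cond_exp_intg[symmetric]) auto
  also have "\<dots> \<le> (\<integral>\<^sup>+\<omega>. ennreal (\<theta>\<^sup>2 * N \<omega> + \<iota>) \<partial>M)"
  proof (rule nn_integral_mono_AE)
    have "AE \<omega> in M. nn_cond_exp M (past_with M G A) e \<omega>
        \<le> ennreal (\<theta>\<^sup>2 * (mnorm (A \<omega>) (v \<omega>))\<^sup>2 + \<iota>)"
      using cond unfolding stoch_norm_cond_def e_def .
    then show "AE \<omega> in M. 1 * nn_cond_exp M (past_with M G A) e \<omega> \<le> ennreal (\<theta>\<^sup>2 * N \<omega> + \<iota>)"
      using AE_space by eventually_elim (simp add: N(1))
  qed
  also have "\<dots> = ennreal (\<integral>\<omega>. \<theta>\<^sup>2 * N \<omega> + \<iota> \<partial>M)"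
    using N(2) N_nonneg \<iota> by (intro nn_integral_eq_integral) auto
  also have "(\<integral>\<omega>. \<theta>\<^sup>2 * N \<omega> + \<iota> \<partial>M) = \<theta>\<^sup>2 * (\<integral>\<omega>. N \<omega> \<partial>M) + \<iota>"
    using N(2) by (simp add: prob_space)
  finally have le: "(\<integral>\<^sup>+\<omega>. ennreal (E \<omega>) \<partial>M) \<le> ennreal (\<theta>\<^sup>2 * (\<integral>\<omega>. N \<omega> \<partial>M) + \<iota>)" .
  have fin: "(\<integral>\<^sup>+\<omega>. ennreal (E \<omega>) \<partial>M) < \<infinity>" by (rule le_less_trans[OF le]) simp
  show int: "integrable M E"
  proof (rule integrableI_nonneg)
    show "AE \<omega> in M. 0 \<le> E \<omega>" using E_nonneg by (rule AE_I2)
  qed (use fin in auto)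
  have "ennreal (\<integral>\<omega>. E \<omega> \<partial>M) \<le> ennreal (\<theta>\<^sup>2 * (\<integral>\<omega>. N \<omega> \<partial>M) + \<iota>)"
    using le nn_integral_eq_integral[OF int] E_nonneg by (simp add: AE_I2)
  moreover have "0 \<le> (\<integral>\<omega>. N \<omega> \<partial>M)" using N_nonneg by (intro integral_nonneg_AE AE_I2)
  ultimately show "(\<integral>\<omega>. E \<omega> \<partial>M) \<le> \<theta>\<^sup>2 * (\<integral>\<omega>. N \<omega> \<partial>M) + \<iota>"
    using \<iota> by (subst (asm) ennreal_le_iff) auto
qed

text \<open>A factor measurable with respect to \<open>G\<close> can be moved through the
  conditional expectation; coordinate by coordinate, this replaces \<open>g\<close> by
  \<open>V\<close> in the expectation of \<open>X \<bullet> g\<close>. Integrability of the products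
  is assumed because it does not follow from that of the factors.\<close>

lemma unbiased_for_orthogonal:
  fixes X g V :: "'w \<Rightarrow> real^'n"
  assumes "prob_space M" and sub: "subalgebra M G" and unb: "unbiased_for M G g V"
    and X: "X \<in> borel_measurable G"
    and Xg: "\<And>i. integrable M (\<lambda>\<omega>. X \<omega> $ i * g \<omega> $ i)"
    and XV: "\<And>i. integrable M (\<lambda>\<omega>. X \<omega> $ i * V \<omega> $ i)"
  shows "integrable M (\<lambda>\<omega>. X \<omega> \<bullet> (g \<omega> - V \<omega>))" and "(\<integral>\<omega>. X \<omega> \<bullet> (g \<omega> - V \<omega>) \<partial>M) = 0"
proof -
  interpret prob_space M by fact
  interpret finite_measure_subalgebra M G
    by unfold_locales (rule sub)
  have g: "g \<in> borel_measurable M"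
    using unb unfolding unbiased_for_def by (intro borel_measurable_integrable) simp
  have eq: "(\<integral>\<omega>. X \<omega> $ i * V \<omega> $ i \<partial>M) = (\<integral>\<omega>. X \<omega> $ i * g \<omega> $ i \<partial>M)" for i
  proof -
    have "(\<integral>\<omega>. X \<omega> $ i * g \<omega> $ i \<partial>M) = (\<integral>\<omega>. X \<omega> $ i * real_cond_exp M G (\<lambda>\<omega>. g \<omega> $ i) \<omega> \<partial>M)"
      by (intro real_cond_exp_intg(2)[symmetric] Xg borel_measurable_nth_vec X g)
    also have "\<dots> = (\<integral>\<omega>. X \<omega> $ i * V \<omega> $ i \<partial>M)"
    proof (rule integral_cong_AE)
      show "(\<lambda>\<omega>. X \<omega> $ i * real_cond_exp M G (\<lambda>\<omega>. g \<omega> $ i) \<omega>) \<in> borel_measurable M"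
        using real_cond_exp_intg(1)[OF Xg borel_measurable_nth_vec[OF X] borel_measurable_nth_vec[OF g]]
        by blast
      show "(\<lambda>\<omega>. X \<omega> $ i * V \<omega> $ i) \<in> borel_measurable M" using XV by blast
      have "AE \<omega> in M. real_cond_exp M G (\<lambda>\<omega>. g \<omega> $ i) \<omega> = V \<omega> $ i"
        using unb unfolding unbiased_for_def by blast
      then show "AE \<omega> in M. X \<omega> $ i * real_cond_exp M G (\<lambda>\<omega>. g \<omega> $ i) \<omega> = X \<omega> $ i * V \<omega> $ i"
        by eventually_elim simp
    qed
    finally show ?thesis by simp
  qed
  have expand: "X \<omega> \<bullet> (g \<omega> - V \<omega>) = (\<Sum>i\<in>UNIV. X \<omega> $ i * g \<omega> $ i - X \<omega> $ i * V \<omega> $ i)" for \<omega>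
    by (simp add: inner_vec_def algebra_simps)
  show "integrable M (\<lambda>\<omega>. X \<omega> \<bullet> (g \<omega> - V \<omega>))" unfolding expand using Xg XV by simp
  show "(\<integral>\<omega>. X \<omega> \<bullet> (g \<omega> - V \<omega>) \<partial>M) = 0" unfolding expand using Xg XV eq by simp
qed

text \<open>The minimum is at most the mean, which gives the rate. Since the bound is uniform in
  \<open>T\<close>, exchanging sum and integral shows that the whole series has finite expectation;
  it is thus almost surely finite and its terms tend to zero.\<close>

lemma bounded_partial_expectations:
  fixes X :: "nat \<Rightarrow> 'w \<Rightarrow> real"
  assumes X: "\<And>k. X k \<in> borel_measurable M" "\<And>k \<omega>. 0 \<le> X k \<omega>" and K: "0 \<le> K"
    and bound: "\<And>T. (\<Sum>k<T. \<integral>\<^sup>+\<omega>. ennreal (X k \<omega>) \<partial>M) \<le> ennreal K"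
  shows "0 < T \<Longrightarrow> (MIN k\<in>{0..T-1}. \<integral>\<^sup>+\<omega>. ennreal (X k \<omega>) \<partial>M) \<le> ennreal (K / real T)"
    and "AE \<omega> in M. summable (\<lambda>k. X k \<omega>)"
    and "AE \<omega> in M. (\<lambda>k. X k \<omega>) \<longlonglongrightarrow> 0"
proof -
  note [measurable] = X(1)
  assume T: "0 < T"
  define m where "m = (MIN k\<in>{0..T-1}. \<integral>\<^sup>+\<omega>. ennreal (X k \<omega>) \<partial>M)"
  have "of_nat (card {..<T}) * m \<le> (\<Sum>k<T. \<integral>\<^sup>+\<omega>. ennreal (X k \<omega>) \<partial>M)"
    unfolding m_def by (intro sum_bounded_below Min_le) auto
  also have "\<dots> \<le> ennreal K" by (rule bound)
  finally have le: "of_nat T * m \<le> ennreal K" by simp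
  show "m \<le> ennreal (K / real T)"
  proof (cases m)
    case (real r)
    then have "ennreal (real T * r) \<le> ennreal K" using le by (simp add: ennreal_mult ennreal_of_nat_eq_real_of_nat)
    then have "real T * r \<le> K" using K by simp
    then have "r \<le> K / real T" using T by (simp add: field_simps)
    then show ?thesis using real by (simp add: ennreal_leI)
  next
    case top
    then show ?thesis using le T by (simp add: ennreal_mult_top top_unique)
  qed
next
  note [measurable] = X(1)
  have "(\<integral>\<^sup>+\<omega>. (\<Sum>k. ennreal (X k \<omega>)) \<partial>M) = (\<Sum>k. \<integral>\<^sup>+\<omega>. ennreal (X k \<omega>) \<partial>M)"
    by (rule nn_integral_suminf) measurable
  also have "\<dots> \<le> ennreal K" unfolding suminf_eq_SUP using bound by (intro SUP_least) auto
  finally have "(\<integral>\<^sup>+\<omega>. (\<Sum>k. ennreal (X k \<omega>)) \<partial>M) \<noteq> \<infinity>" by (auto simp: top_unique)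
  then have "AE \<omega> in M. (\<Sum>k. ennreal (X k \<omega>)) \<noteq> \<infinity>" by (intro nn_integral_PInf_AE) measurable
  then show sum: "AE \<omega> in M. summable (\<lambda>k. X k \<omega>)"
    by eventually_elim (auto intro: summable_suminf_not_top X(2))
  show "AE \<omega> in M. (\<lambda>k. X k \<omega>) \<longlonglongrightarrow> 0"
    using sum by eventually_elim (rule summable_LIMSEQ_zero)
qed

section \<open>The stochastic Newton iteration\<close>

text \<open>What remains of the setting once sampling and averaging have been dealt with: a function
  with a quadratic upper bound, symmetric matrices between \<open>\<mu>\<close> and
  \<open>Lt\<close>, and a constant step length. The sigma-algebras to condition on are left to the
  lemmas, since the norm condition and unbiasedness use different ones.\<close>

locale stochastic_newton = prob_space M for M :: "'w measure" +
  fixes f :: "real^'n \<Rightarrow> real" and L Lt \<mu> fmin a :: real and w0 :: "real^'n"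
    and w g :: "nat \<Rightarrow> 'w \<Rightarrow> real^'n" and H :: "nat \<Rightarrow> 'w \<Rightarrow> real^'n^'n"
  assumes diff: "\<And>x. f differentiable (at x)"
    and upper: "\<And>x h. f (x + h) \<le> f x + h \<bullet> grad f x + L / 2 * (norm h)\<^sup>2"
    and pos: "0 < L" "0 < \<mu>" "0 < a"
    and below: "\<And>x. fmin \<le> f x"
    and w_meas [measurable]: "\<And>k. w k \<in> borel_measurable M"
    and g_meas [measurable]: "\<And>k. g k \<in> borel_measurable M"
    and H_meas [measurable]: "\<And>k. H k \<in> borel_measurable M"
    and H_sym: "\<And>k \<omega>. \<omega> \<in> space M \<Longrightarrow> transpose (H k \<omega>) = H k \<omega>"
    and H_lower: "\<And>k \<omega> x. \<omega> \<in> space M \<Longrightarrow> \<mu> * (norm x)\<^sup>2 \<le> x \<bullet> (H k \<omega> *v x)"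
    and H_upper: "\<And>k \<omega> x. \<omega> \<in> space M \<Longrightarrow> x \<bullet> (H k \<omega> *v x) \<le> Lt * (norm x)\<^sup>2"
    and w_init: "\<And>\<omega>. \<omega> \<in> space M \<Longrightarrow> w 0 \<omega> = w0"
    and w_step: "\<And>k \<omega>. \<omega> \<in> space M \<Longrightarrow>
      w (Suc k) \<omega> = w k \<omega> - a *\<^sub>R (matrix_inv (H k \<omega>) *v g k \<omega>)"
begin

definition "V k \<omega> = grad f (w k \<omega>)"
definition "P k \<omega> = matrix_inv (H k \<omega>)"
text \<open>\<open>grad_sq\<close> and \<open>err_sq\<close> are squared norms with weight
  \<open>P\<close>, written as quadratic forms, and \<open>cross\<close> is their mixed term. The
  bound for one step is a linear combination of these three.\<close>

definition "grad_sq k \<omega> = V k \<omega> \<bullet> (P k \<omega> *v V k \<omega>)"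
definition "err_sq k \<omega> = (g k \<omega> - V k \<omega>) \<bullet> (P k \<omega> *v (g k \<omega> - V k \<omega>))"
definition "cross k \<omega> = (P k \<omega> *v V k \<omega>) \<bullet> (g k \<omega> - V k \<omega>)"

section \<open>Pointwise bounds on the inverse matrices and on one step\<close>

lemma inverse_bounds:
  assumes \<omega>: "\<omega> \<in> space M"
  shows "det (H k \<omega>) \<noteq> 0" and "H k \<omega> *v (P k \<omega> *v x) = x"
    and "x \<bullet> (P k \<omega> *v y) = (P k \<omega> *v x) \<bullet> y"
    and "\<mu> * (norm (P k \<omega> *v x))\<^sup>2 \<le> x \<bullet> (P k \<omega> *v x)"
    and "\<mu> * norm (P k \<omega> *v x) \<le> norm x"
    and "\<mu> * (x \<bullet> (P k \<omega> *v x)) \<le> (norm x)\<^sup>2"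
    and "0 < Lt" and "(norm x)\<^sup>2 \<le> Lt * (x \<bullet> (P k \<omega> *v x))"
  unfolding P_def
  by (fact inverse_between[OF H_sym[OF \<omega>] pos(2) H_lower[OF \<omega>] H_upper[OF \<omega>]])+

text \<open>The matrix bounds hold at the points of \<open>space M\<close>, and a probability space
  has at least one.\<close>

lemma Lt_pos: "0 < Lt"
  using inverse_bounds(7) not_empty by blast

lemma V_meas [measurable]: "V k \<in> borel_measurable M"
  unfolding V_def by (rule measurable_compose[OF w_meas borel_measurable_grad[OF diff]])

text \<open>A general \<open>N\<close> on the same space is allowed so that \<open>P V\<close> can
  be shown measurable for the past together with \<open>H k\<close>.\<close>

lemma P_mult_meas:
  assumes "space N = space M" "H k \<in> borel_measurable N" "x \<in> borel_measurable N"
  shows "(\<lambda>\<omega>. P k \<omega> *v x \<omega>) \<in> borel_measurable N"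
  unfolding P_def using assms inverse_bounds(1,2)[unfolded P_def]
  by (intro borel_measurable_matrix_inv_mult) auto

lemma P_mult_meas_M [measurable]:
  "x \<in> borel_measurable M \<Longrightarrow> (\<lambda>\<omega>. P k \<omega> *v x \<omega>) \<in> borel_measurable M"
  by (rule P_mult_meas) auto

lemma sq_meas [measurable]:
  "grad_sq k \<in> borel_measurable M" "err_sq k \<in> borel_measurable M" "cross k \<in> borel_measurable M"
  unfolding grad_sq_def err_sq_def cross_def by measurable

lemma f_w_meas [measurable]: "(\<lambda>\<omega>. f (w k \<omega>)) \<in> borel_measurable M"
proof -
  have "continuous_on UNIV f"
    using diff by (simp add: continuous_on_eq_continuous_within differentiable_imp_continuous_within)
  then have [measurable]: "f \<in> borel_measurable borel" by (rule borel_measurable_continuous_onI)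
  show ?thesis by measurable
qed

lemma sq_bounds:
  assumes "\<omega> \<in> space M"
  shows "0 \<le> x \<bullet> (P k \<omega> *v x)" "(norm x)\<^sup>2 \<le> Lt * (x \<bullet> (P k \<omega> *v x))"
    "x \<bullet> (P k \<omega> *v x) \<le> (norm x)\<^sup>2 / \<mu>"
proof -
  have "0 \<le> \<mu> * (norm (P k \<omega> *v x))\<^sup>2" using pos by simp
  then show "0 \<le> x \<bullet> (P k \<omega> *v x)" using inverse_bounds(4)[OF assms] by (rule order_trans)
  show "(norm x)\<^sup>2 \<le> Lt * (x \<bullet> (P k \<omega> *v x))" using inverse_bounds(8)[OF assms] .
  show "x \<bullet> (P k \<omega> *v x) \<le> (norm x)\<^sup>2 / \<mu>"
    using inverse_bounds(6)[OF assms, of x k] pos by (simp add: field_simps)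
qed

lemma norm_V_le: "\<omega> \<in> space M \<Longrightarrow> (norm (V k \<omega>))\<^sup>2 \<le> Lt * grad_sq k \<omega>"
  unfolding grad_sq_def by (rule sq_bounds(2))

text \<open>The step \<open>- grad f x / L\<close> minimizes the quadratic model at
  \<open>x\<close>, and the value of the model there still lies above \<open>fmin\<close>.\<close>

lemma norm_grad_le: "(norm (grad f x))\<^sup>2 \<le> 2 * L * (f x - fmin)"
proof -
  have "fmin \<le> f (x + (- 1 / L) *\<^sub>R grad f x)" by (rule below)
  also have "\<dots> \<le> f x + ((- 1 / L) *\<^sub>R grad f x) \<bullet> grad f x + L / 2 * (norm ((- 1 / L) *\<^sub>R grad f x))\<^sup>2"
    by (rule upper)
  also have "\<dots> = f x - (norm (grad f x))\<^sup>2 / (2 * L)"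
    using pos by (simp add: power2_norm_eq_inner[symmetric] power_divide power2_eq_square field_simps)
  finally show ?thesis using pos by (simp add: field_simps)
qed

text \<open>The quadratic upper bound for the step \<open>- a P g\<close>, with
  \<open>norm (P g)^2\<close> replaced by \<open>(g \<bullet> P g) / \<mu>\<close> so that every
  term is a form in \<open>P\<close>; symmetry of \<open>P\<close> merges the two mixed terms. The
  second claim is \<open>0 \<le> g \<bullet> P g\<close> in expanded form; it permits enlarging the
  coefficient in the biased case.\<close>

lemma step_bound:
  assumes \<omega>: "\<omega> \<in> space M"
  shows "f (w (Suc k) \<omega>) \<le> f (w k \<omega>) - a * (grad_sq k \<omega> + cross k \<omega>)
      + L * a\<^sup>2 / (2 * \<mu>) * (grad_sq k \<omega> + 2 * cross k \<omega> + err_sq k \<omega>)"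
    and "0 \<le> grad_sq k \<omega> + 2 * cross k \<omega> + err_sq k \<omega>"
proof -
  define e where "e = g k \<omega> - V k \<omega>"
  have g: "g k \<omega> = V k \<omega> + e" by (simp add: e_def)
  have Pg: "P k \<omega> *v g k \<omega> = P k \<omega> *v V k \<omega> + P k \<omega> *v e"
    by (simp add: g matrix_vector_right_distrib)
  have swap: "V k \<omega> \<bullet> (P k \<omega> *v e) = (P k \<omega> *v V k \<omega>) \<bullet> e" by (rule inverse_bounds(3)[OF \<omega>])
  have VPg: "V k \<omega> \<bullet> (P k \<omega> *v g k \<omega>) = grad_sq k \<omega> + cross k \<omega>"
    unfolding Pg grad_sq_def cross_def e_def[symmetric] by (simp add: inner_add_right swap)
  have gPg: "g k \<omega> \<bullet> (P k \<omega> *v g k \<omega>) = grad_sq k \<omega> + 2 * cross k \<omega> + err_sq k \<omega>"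
    unfolding Pg grad_sq_def cross_def err_sq_def e_def[symmetric]
    by (subst g) (simp add: inner_add_right inner_add_left swap inner_commute)
  then show "0 \<le> grad_sq k \<omega> + 2 * cross k \<omega> + err_sq k \<omega>" using sq_bounds(1)[OF \<omega>] by metis
  have "f (w (Suc k) \<omega>) = f (w k \<omega> + (- a) *\<^sub>R (P k \<omega> *v g k \<omega>))"
    using w_step[OF \<omega>] by (simp add: P_def)
  also have "\<dots> \<le> f (w k \<omega>) + ((- a) *\<^sub>R (P k \<omega> *v g k \<omega>)) \<bullet> V k \<omega>
      + L / 2 * (norm ((- a) *\<^sub>R (P k \<omega> *v g k \<omega>)))\<^sup>2"
    unfolding V_def by (rule upper)
  also have "\<dots> = f (w k \<omega>) - a * (grad_sq k \<omega> + cross k \<omega>) + L * a\<^sup>2 / 2 * (norm (P k \<omega> *v g k \<omega>))\<^sup>2"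
    unfolding VPg[symmetric] by (simp add: power_mult_distrib inner_commute)
  also have "\<dots> \<le> f (w k \<omega>) - a * (grad_sq k \<omega> + cross k \<omega>)
      + L * a\<^sup>2 / 2 * ((g k \<omega> \<bullet> (P k \<omega> *v g k \<omega>)) / \<mu>)"
    using inverse_bounds(4)[OF \<omega>, of k "g k \<omega>"] pos
    by (intro add_left_mono mult_left_mono) (auto simp: field_simps)
  finally show "f (w (Suc k) \<omega>) \<le> f (w k \<omega>) - a * (grad_sq k \<omega> + cross k \<omega>)
      + L * a\<^sup>2 / (2 * \<mu>) * (grad_sq k \<omega> + 2 * cross k \<omega> + err_sq k \<omega>)"
    unfolding gPg by simp
qed

section \<open>Integrability and expected decrease over one step\<close>

lemma integrable_gradients:
  assumes int: "integrable M (\<lambda>\<omega>. f (w k \<omega>))"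
  shows "integrable M (\<lambda>\<omega>. (norm (V k \<omega>))\<^sup>2)" and "integrable M (grad_sq k)"
proof -
  show 1: "integrable M (\<lambda>\<omega>. (norm (V k \<omega>))\<^sup>2)"
  proof (rule Bochner_Integration.integrable_bound)
    show "integrable M (\<lambda>\<omega>. 2 * L * (f (w k \<omega>) - fmin))" using int by simp
    show "AE \<omega> in M. norm ((norm (V k \<omega>))\<^sup>2) \<le> norm (2 * L * (f (w k \<omega>) - fmin))"
      unfolding V_def using norm_grad_le by (intro AE_I2) (simp add: order_trans[OF _ abs_ge_self])
  qed measurable
  show "integrable M (grad_sq k)"
  proof (rule Bochner_Integration.integrable_bound)
    show "integrable M (\<lambda>\<omega>. (norm (V k \<omega>))\<^sup>2 / \<mu>)" using 1 by simp
    show "AE \<omega> in M. norm (grad_sq k \<omega>) \<le> norm ((norm (V k \<omega>))\<^sup>2 / \<mu>)"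
      unfolding grad_sq_def using sq_bounds pos by (intro AE_I2) simp
  qed measurable
qed

text \<open>The next value is squeezed between \<open>fmin\<close> and an integrable bound.\<close>

lemma integrable_next:
  assumes "integrable M B" and "\<And>\<omega>. \<omega> \<in> space M \<Longrightarrow> f (w (Suc k) \<omega>) \<le> B \<omega>"
  shows "integrable M (\<lambda>\<omega>. f (w (Suc k) \<omega>))"
    and "(\<integral>\<omega>. f (w (Suc k) \<omega>) \<partial>M) \<le> (\<integral>\<omega>. B \<omega> \<partial>M)"
proof -
  show "integrable M (\<lambda>\<omega>. f (w (Suc k) \<omega>))"
  proof (rule Bochner_Integration.integrable_bound)
    show "integrable M (\<lambda>\<omega>. \<bar>B \<omega>\<bar> + \<bar>fmin\<bar>)" using assms(1) by simp
    have "\<bar>f (w (Suc k) \<omega>)\<bar> \<le> \<bar>B \<omega>\<bar> + \<bar>fmin\<bar>" if "\<omega> \<in> space M" for \<omega>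
      using assms(2)[OF that] below[of "w (Suc k) \<omega>"] by linarith
    then show "AE \<omega> in M. norm (f (w (Suc k) \<omega>)) \<le> norm (\<bar>B \<omega>\<bar> + \<bar>fmin\<bar>)" by simp
  qed measurable
  then show "(\<integral>\<omega>. f (w (Suc k) \<omega>) \<partial>M) \<le> (\<integral>\<omega>. B \<omega> \<partial>M)"
    using assms by (intro integral_mono)
qed

text \<open>The step length allows the coefficient of the square to be enlarged to
  \<open>a / 2\<close>. The mixed part of the square then cancels the linear term
  \<open>- a * cross\<close> exactly, and \<open>a / 2 * (err_sq - grad_sq)\<close> remains. The
  cancellation is pointwise, so a bias of \<open>g\<close> does no harm.\<close>

lemma descent_biased:
  assumes a: "a \<le> \<mu> / L" and int: "integrable M (\<lambda>\<omega>. f (w k \<omega>))"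
    and E: "integrable M (err_sq k)" "(\<integral>\<omega>. err_sq k \<omega> \<partial>M) \<le> \<theta>\<^sup>2 * (\<integral>\<omega>. grad_sq k \<omega> \<partial>M) + \<iota>"
  shows "integrable M (\<lambda>\<omega>. f (w (Suc k) \<omega>)) \<and>
    (\<integral>\<omega>. f (w (Suc k) \<omega>) \<partial>M) + a / 2 * (1 - \<theta>\<^sup>2) * (\<integral>\<omega>. grad_sq k \<omega> \<partial>M)
      \<le> (\<integral>\<omega>. f (w k \<omega>) \<partial>M) + a / 2 * \<iota>"
proof -
  define B where "B \<omega> = f (w k \<omega>) - a / 2 * grad_sq k \<omega> + a / 2 * err_sq k \<omega>" for \<omega>
  note N = integrable_gradients(2)[OF int]
  have s: "L * a\<^sup>2 / (2 * \<mu>) \<le> a / 2"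
    using a pos by (simp add: field_simps power2_eq_square)
  have "f (w (Suc k) \<omega>) \<le> B \<omega>" if "\<omega> \<in> space M" for \<omega>
    using step_bound(1)[OF that, of k] mult_right_mono[OF s step_bound(2)[OF that, of k]]
    unfolding B_def by (simp add: algebra_simps)
  moreover have "integrable M B" unfolding B_def using N int E(1) by simp
  ultimately have nxt: "integrable M (\<lambda>\<omega>. f (w (Suc k) \<omega>))"
    "(\<integral>\<omega>. f (w (Suc k) \<omega>) \<partial>M) \<le> (\<integral>\<omega>. B \<omega> \<partial>M)"
    using integrable_next by blast+
  have "(\<integral>\<omega>. B \<omega> \<partial>M) = (\<integral>\<omega>. f (w k \<omega>) \<partial>M) - a / 2 * (\<integral>\<omega>. grad_sq k \<omega> \<partial>M)
      + a / 2 * (\<integral>\<omega>. err_sq k \<omega> \<partial>M)"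
    unfolding B_def using N int E(1) by simp
  moreover have "a / 2 * (\<integral>\<omega>. err_sq k \<omega> \<partial>M) \<le> a / 2 * (\<theta>\<^sup>2 * (\<integral>\<omega>. grad_sq k \<omega> \<partial>M) + \<iota>)"
    using E(2) pos by (intro mult_left_mono) auto
  ultimately show ?thesis using nxt by (simp add: algebra_simps)
qed

text \<open>\<open>c\<close> and \<open>\<iota>\<close> are parameters because the two metrics lead
  to different values: \<open>\<theta>g^2\<close> and \<open>\<iota> k\<close> for the inverse of
  \<open>H k\<close>, \<open>\<theta>g^2 * Lt / \<mu>\<close> and \<open>\<iota> k / \<mu>\<close>
  for the identity. The step length bound amounts to \<open>s * (1 + c) \<le> a / 2\<close>, which
  absorbs \<open>s * grad_sq\<close> together with the share \<open>s * c * grad_sq\<close> of the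
  error.\<close>

lemma descent_unbiased:
  assumes G: "subalgebra M G" "w k \<in> borel_measurable G" "H k \<in> borel_measurable G"
    and unb: "unbiased_for M G (g k) (V k)"
    and c: "0 \<le> c" "a \<le> \<mu> / (L * (1 + c))" and int: "integrable M (\<lambda>\<omega>. f (w k \<omega>))"
    and E: "integrable M (err_sq k)" "(\<integral>\<omega>. err_sq k \<omega> \<partial>M) \<le> c * (\<integral>\<omega>. grad_sq k \<omega> \<partial>M) + \<iota>"
  shows "integrable M (\<lambda>\<omega>. f (w (Suc k) \<omega>)) \<and>
    (\<integral>\<omega>. f (w (Suc k) \<omega>) \<partial>M) + a / 2 * (\<integral>\<omega>. grad_sq k \<omega> \<partial>M)
      \<le> (\<integral>\<omega>. f (w k \<omega>) \<partial>M) + L * a\<^sup>2 / (2 * \<mu>) * \<iota>"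
proof -
  define s where "s = L * a\<^sup>2 / (2 * \<mu>)"
  have "0 < L * (1 + c)" using c pos by simp
  then have "a * (L * (1 + c)) \<le> \<mu>" using c(2) by (simp add: pos_le_divide_eq)
  then have "a / (2 * \<mu>) * (a * (L * (1 + c))) \<le> a / (2 * \<mu>) * \<mu>"
    using pos by (intro mult_left_mono) auto
  moreover have "s * (1 + c) = a / (2 * \<mu>) * (a * (L * (1 + c)))"
    unfolding s_def power2_eq_square by simp
  ultimately have "s * (1 + c) \<le> a / (2 * \<mu>) * \<mu>" by simp
  then have s: "0 \<le> s" "s * (1 + c) \<le> a / 2" using pos unfolding s_def by simp_all
  note V = integrable_gradients(1)[OF int] and N = integrable_gradients(2)[OF int]
  define X where "X \<omega> = P k \<omega> *v V k \<omega>" for \<omega>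
  have space_G: "space G = space M" using G(1) unfolding subalgebra_def by simp
  \<comment> \<open>\<open>P V\<close> depends only on \<open>w k\<close> and \<open>H k\<close>,
    both measurable for \<open>G\<close>; this makes it an admissible multiplier for
    unbiasedness.\<close>
  have X_G: "X \<in> borel_measurable G"
    unfolding X_def V_def using G(2,3) space_G
    by (intro P_mult_meas measurable_compose[OF _ borel_measurable_grad[OF diff]])
  have X_M [measurable]: "X \<in> borel_measurable M" unfolding X_def by measurable
  have X_le: "norm (X \<omega>) \<le> norm (V k \<omega>) / \<mu>" if "\<omega> \<in> space M" for \<omega>
    using inverse_bounds(5)[OF that] pos unfolding X_def by (simp add: field_simps)
  note [measurable] = borel_measurable_nth_vec[OF X_M] borel_measurable_nth_vec[OF V_meas]
    borel_measurable_nth_vec[OF g_meas]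
  have XV: "integrable M (\<lambda>\<omega>. X \<omega> $ i * V k \<omega> $ i)" for i
  proof (rule Bochner_Integration.integrable_bound)
    show "integrable M (\<lambda>\<omega>. (norm (V k \<omega>))\<^sup>2 / \<mu>)" using V by simp
    have "\<bar>X \<omega> $ i * V k \<omega> $ i\<bar> \<le> (norm (V k \<omega>))\<^sup>2 / \<mu>" if "\<omega> \<in> space M" for \<omega>
    proof -
      have "\<bar>X \<omega> $ i\<bar> * \<bar>V k \<omega> $ i\<bar> \<le> (norm (V k \<omega>) / \<mu>) * norm (V k \<omega>)"
        using X_le[OF that] component_le_norm_cart pos
        by (intro mult_mono) (auto intro: order_trans)
      then show ?thesis by (simp add: abs_mult power2_eq_square)
    qed
    then show "AE \<omega> in M. norm (X \<omega> $ i * V k \<omega> $ i) \<le> norm ((norm (V k \<omega>))\<^sup>2 / \<mu>)"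
      using pos by simp
  qed measurable
  \<comment> \<open>The deviation of \<open>g\<close> is controlled only through its square. The
    product is therefore bounded by \<open>x (x + y) / \<mu>\<close> with \<open>x = |V|\<close> and
    \<open>y = |g - V|\<close>, the mixed term by squares, and \<open>y^2\<close> by
    \<open>Lt * err_sq\<close>.\<close>
  have Xg: "integrable M (\<lambda>\<omega>. X \<omega> $ i * g k \<omega> $ i)" for i
  proof (rule Bochner_Integration.integrable_bound)
    show "integrable M (\<lambda>\<omega>. (2 * (norm (V k \<omega>))\<^sup>2 + Lt * err_sq k \<omega>) / \<mu>)" using V E(1) by simp
    have "\<bar>X \<omega> $ i * g k \<omega> $ i\<bar> \<le> (2 * (norm (V k \<omega>))\<^sup>2 + Lt * err_sq k \<omega>) / \<mu>"
      if "\<omega> \<in> space M" for \<omega>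
    proof -
      define x y where "x = norm (V k \<omega>)" and "y = norm (g k \<omega> - V k \<omega>)"
      have "\<bar>g k \<omega> $ i\<bar> \<le> norm (g k \<omega>)" by (rule component_le_norm_cart)
      also have "\<dots> \<le> x + y" unfolding x_def y_def using norm_triangle_sub by blast
      finally have "\<bar>g k \<omega> $ i\<bar> \<le> x + y" .
      moreover have "\<bar>X \<omega> $ i\<bar> \<le> x / \<mu>"
        using X_le[OF that] component_le_norm_cart[of "X \<omega>" i] unfolding x_def by linarith
      ultimately have "\<bar>X \<omega> $ i\<bar> * \<bar>g k \<omega> $ i\<bar> \<le> x / \<mu> * (x + y)"
        using pos by (intro mult_mono) (auto simp: x_def)
      also have "\<dots> = (x\<^sup>2 + x * y) / \<mu>" by (simp add: power2_eq_square algebra_simps)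
      also have "\<dots> \<le> (2 * x\<^sup>2 + y\<^sup>2) / \<mu>"
      proof (rule divide_right_mono)
        have "0 \<le> x * y" by (simp add: x_def y_def)
        then have "x * y \<le> x\<^sup>2 + y\<^sup>2" using sum_squares_bound[of x y] by linarith
        then show "x\<^sup>2 + x * y \<le> 2 * x\<^sup>2 + y\<^sup>2" by simp
      qed (use pos in simp)
      also have "\<dots> \<le> (2 * x\<^sup>2 + Lt * err_sq k \<omega>) / \<mu>"
        using sq_bounds(2)[OF that] pos unfolding y_def err_sq_def
        by (intro divide_right_mono add_left_mono) auto
      finally show ?thesis unfolding x_def by (simp add: abs_mult)
    qed
    then show "AE \<omega> in M. norm (X \<omega> $ i * g k \<omega> $ i)
        \<le> norm ((2 * (norm (V k \<omega>))\<^sup>2 + Lt * err_sq k \<omega>) / \<mu>)"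
      unfolding real_norm_def by (intro AE_I2 order_trans[OF _ abs_ge_self])
  qed measurable
  have C: "integrable M (cross k)" "(\<integral>\<omega>. cross k \<omega> \<partial>M) = 0"
    using unbiased_for_orthogonal[OF prob_space_axioms G(1) unb X_G Xg XV]
    unfolding cross_def[abs_def] X_def by auto
  define B where "B \<omega> = f (w k \<omega>) - a * (grad_sq k \<omega> + cross k \<omega>)
      + s * (grad_sq k \<omega> + 2 * cross k \<omega> + err_sq k \<omega>)" for \<omega>
  have "f (w (Suc k) \<omega>) \<le> B \<omega>" if "\<omega> \<in> space M" for \<omega>
    using step_bound(1)[OF that, of k] unfolding B_def s_def .
  moreover have "integrable M B" unfolding B_def using N int E(1) C(1) by simp
  ultimately have nxt: "integrable M (\<lambda>\<omega>. f (w (Suc k) \<omega>))"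
    "(\<integral>\<omega>. f (w (Suc k) \<omega>) \<partial>M) \<le> (\<integral>\<omega>. B \<omega> \<partial>M)"
    using integrable_next by blast+
  have "(\<integral>\<omega>. B \<omega> \<partial>M) = (\<integral>\<omega>. f (w k \<omega>) \<partial>M) - a * (\<integral>\<omega>. grad_sq k \<omega> \<partial>M)
      + s * ((\<integral>\<omega>. grad_sq k \<omega> \<partial>M) + (\<integral>\<omega>. err_sq k \<omega> \<partial>M))"
    unfolding B_def using N int E(1) C by simp
  moreover have "s * (\<integral>\<omega>. err_sq k \<omega> \<partial>M) \<le> s * (c * (\<integral>\<omega>. grad_sq k \<omega> \<partial>M) + \<iota>)"
    using E(2) s by (intro mult_left_mono) auto
  moreover have "0 \<le> (\<integral>\<omega>. grad_sq k \<omega> \<partial>M)"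
    using sq_bounds(1) unfolding grad_sq_def by (intro integral_nonneg_AE AE_I2)
  then have "s * (1 + c) * (\<integral>\<omega>. grad_sq k \<omega> \<partial>M) \<le> a / 2 * (\<integral>\<omega>. grad_sq k \<omega> \<partial>M)"
    using s by (intro mult_right_mono)
  ultimately show ?thesis using nxt unfolding s_def[symmetric] by (simp add: algebra_simps)
qed

text \<open>Telescoping, with \<open>c\<close> the guaranteed decrease per unit of
  \<open>grad_sq\<close> and \<open>b\<close> the cost per unit of \<open>\<iota>\<close>; the
  factor \<open>Lt\<close> in \<open>K\<close> converts \<open>grad_sq\<close> into Euclidean
  squares. Since \<open>step\<close> speaks only under integrability of the current value,
  integrability of all iterates is settled by induction from the constant start.\<close>

lemma expected_gradients_bounded:
  assumes step: "\<And>k. integrable M (\<lambda>\<omega>. f (w k \<omega>)) \<Longrightarrow> integrable M (\<lambda>\<omega>. f (w (Suc k) \<omega>)) \<and>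
      (\<integral>\<omega>. f (w (Suc k) \<omega>) \<partial>M) + c * (\<integral>\<omega>. grad_sq k \<omega> \<partial>M) \<le> (\<integral>\<omega>. f (w k \<omega>) \<partial>M) + b * \<iota> k"
    and pos': "0 < c" "0 \<le> b" and \<iota>: "\<And>k. 0 < \<iota> k" "\<iota> sums itot"
    and K: "K = Lt / c * (f w0 - fmin + b * itot)"
  shows "0 < T \<Longrightarrow> (MIN k\<in>{0..T-1}. \<integral>\<^sup>+\<omega>. ennreal ((norm (grad f (w k \<omega>)))\<^sup>2) \<partial>M) \<le> ennreal (K / real T)"
    and "AE \<omega> in M. summable (\<lambda>k. (norm (grad f (w k \<omega>)))\<^sup>2)"
    and "AE \<omega> in M. (\<lambda>k. (norm (grad f (w k \<omega>)))\<^sup>2) \<longlonglongrightarrow> 0"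
proof -
  have f0: "integrable M (\<lambda>\<omega>. f (w 0 \<omega>))" "(\<integral>\<omega>. f (w 0 \<omega>) \<partial>M) = f w0"
    using w_init by (simp_all add: prob_space cong: Bochner_Integration.integrable_cong Bochner_Integration.integral_cong)
  have int: "integrable M (\<lambda>\<omega>. f (w k \<omega>))" for k
    by (induction k) (use f0 step in auto)
  have tele: "(\<integral>\<omega>. f (w T \<omega>) \<partial>M) + c * (\<Sum>k<T. \<integral>\<omega>. grad_sq k \<omega> \<partial>M) \<le> f w0 + b * (\<Sum>k<T. \<iota> k)" for T
  proof (induction T)
    case (Suc T)
    with step[OF int, of T] show ?case by (simp add: algebra_simps)
  qed (simp add: f0)
  have itot: "(\<Sum>k<T. \<iota> k) \<le> itot" for T
    using sum_le_suminf[of \<iota> "{..<T}"] \<iota> by (simp add: sums_iff less_imp_le)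
  \<comment> \<open>\<open>itot[of 0]\<close> compares with the empty sum and supplies nonnegativity
    of the total.\<close>
  have K0: "0 \<le> K"
    using Lt_pos pos' below[of w0] itot[of 0] unfolding K by simp
  have "(\<Sum>k<T. \<integral>\<^sup>+\<omega>. ennreal ((norm (V k \<omega>))\<^sup>2) \<partial>M) \<le> ennreal K" for T
  proof -
    note V = integrable_gradients(1)[OF int] and N = integrable_gradients(2)[OF int]
    have "(\<integral>\<omega>. fmin \<partial>M) \<le> (\<integral>\<omega>. f (w T \<omega>) \<partial>M)" using int below by (intro integral_mono) auto
    then have lo: "fmin \<le> (\<integral>\<omega>. f (w T \<omega>) \<partial>M)" by (simp add: prob_space)
    have "b * (\<Sum>k<T. \<iota> k) \<le> b * itot" using itot pos' by (intro mult_left_mono) auto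
    with tele[of T] lo have "c * (\<Sum>k<T. \<integral>\<omega>. grad_sq k \<omega> \<partial>M) \<le> f w0 - fmin + b * itot" by linarith
    then have sumN: "Lt * (\<Sum>k<T. \<integral>\<omega>. grad_sq k \<omega> \<partial>M) \<le> K"
    proof -
      assume "c * (\<Sum>k<T. \<integral>\<omega>. grad_sq k \<omega> \<partial>M) \<le> f w0 - fmin + b * itot"
      then have "(\<Sum>k<T. \<integral>\<omega>. grad_sq k \<omega> \<partial>M) \<le> (f w0 - fmin + b * itot) / c"
        using pos' by (simp add: pos_le_divide_eq mult.commute)
      then have "Lt * (\<Sum>k<T. \<integral>\<omega>. grad_sq k \<omega> \<partial>M) \<le> Lt * ((f w0 - fmin + b * itot) / c)"
        using Lt_pos by (intro mult_left_mono) auto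
      then show ?thesis unfolding K by simp
    qed
    have "(\<Sum>k<T. \<integral>\<^sup>+\<omega>. ennreal ((norm (V k \<omega>))\<^sup>2) \<partial>M) = (\<Sum>k<T. ennreal (\<integral>\<omega>. (norm (V k \<omega>))\<^sup>2 \<partial>M))"
      by (intro sum.cong refl nn_integral_eq_integral V) simp
    also have "\<dots> = ennreal (\<Sum>k<T. \<integral>\<omega>. (norm (V k \<omega>))\<^sup>2 \<partial>M)" by (intro sum_ennreal) simp
    also have "\<dots> \<le> ennreal K"
    proof (rule ennreal_leI)
      have "(\<Sum>k<T. \<integral>\<omega>. (norm (V k \<omega>))\<^sup>2 \<partial>M) \<le> (\<Sum>k<T. \<integral>\<omega>. Lt * grad_sq k \<omega> \<partial>M)"
        using V N norm_V_le by (intro sum_mono integral_mono) auto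
      also have "\<dots> = Lt * (\<Sum>k<T. \<integral>\<omega>. grad_sq k \<omega> \<partial>M)" by (simp add: sum_distrib_left)
      finally show "(\<Sum>k<T. \<integral>\<omega>. (norm (V k \<omega>))\<^sup>2 \<partial>M) \<le> K" using sumN by linarith
    qed
    finally show ?thesis .
  qed
  note concl = bounded_partial_expectations[of "\<lambda>k \<omega>. (norm (V k \<omega>))\<^sup>2" M K, OF _ _ K0 this]
  show "0 < T \<Longrightarrow> (MIN k\<in>{0..T-1}. \<integral>\<^sup>+\<omega>. ennreal ((norm (grad f (w k \<omega>)))\<^sup>2) \<partial>M) \<le> ennreal (K / real T)"
    using concl(1) unfolding V_def[symmetric] by simp
  show "AE \<omega> in M. summable (\<lambda>k. (norm (grad f (w k \<omega>)))\<^sup>2)"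
    using concl(2) unfolding V_def[symmetric] by simp
  show "AE \<omega> in M. (\<lambda>k. (norm (grad f (w k \<omega>)))\<^sup>2) \<longlonglongrightarrow> 0"
    using concl(3) unfolding V_def[symmetric] by simp
qed

lemma newton_norm_cond:
  assumes A: "\<And>\<omega>. \<omega> \<in> space M \<Longrightarrow> A \<omega> = P k \<omega>"
    and sub: "subalgebra M (past_with M G A)"
    and cond: "stoch_norm_cond M G A (g k) (\<lambda>\<omega>. grad f (w k \<omega>)) \<theta> \<iota>" and "0 \<le> \<iota>"
    and int: "integrable M (\<lambda>\<omega>. f (w k \<omega>))"
  shows "integrable M (err_sq k)"
    and "(\<integral>\<omega>. err_sq k \<omega> \<partial>M) \<le> \<theta>\<^sup>2 * (\<integral>\<omega>. grad_sq k \<omega> \<partial>M) + \<iota>"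
  using stoch_norm_cond_expectation[OF prob_space_axioms sub cond \<open>0 \<le> \<iota>\<close>, of "err_sq k" "grad_sq k"]
    integrable_gradients(2)[OF int] sq_bounds(1) A
  by (auto simp: mnorm_power2 err_sq_def grad_sq_def V_def)

text \<open>Passing from the Euclidean metric to \<open>P\<close> costs \<open>1 / \<mu>\<close> on
  the error and \<open>Lt\<close> on the gradient. This produces the constant
  \<open>\<theta>^2 * Lt / \<mu>\<close> of the second step length bound and the error level
  \<open>\<iota> / \<mu>\<close>.\<close>

lemma euclidean_norm_cond:
  assumes A: "\<And>\<omega>. \<omega> \<in> space M \<Longrightarrow> A \<omega> = mat 1"
    and sub: "subalgebra M (past_with M G A)"
    and cond: "stoch_norm_cond M G A (g k) (\<lambda>\<omega>. grad f (w k \<omega>)) \<theta> \<iota>" and "0 \<le> \<iota>"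
    and int: "integrable M (\<lambda>\<omega>. f (w k \<omega>))"
  shows "integrable M (err_sq k)"
    and "(\<integral>\<omega>. err_sq k \<omega> \<partial>M) \<le> \<theta>\<^sup>2 * Lt / \<mu> * (\<integral>\<omega>. grad_sq k \<omega> \<partial>M) + \<iota> / \<mu>"
proof -
  define e where "e \<omega> = (norm (g k \<omega> - V k \<omega>))\<^sup>2" for \<omega>
  have [measurable]: "e \<in> borel_measurable M" unfolding e_def by measurable
  note V = integrable_gradients(1)[OF int] and N = integrable_gradients(2)[OF int]
  have mn: "(mnorm (A \<omega>) v)\<^sup>2 = (norm v)\<^sup>2" if "\<omega> \<in> space M" for \<omega> v
    using A[OF that] by (simp add: mnorm_def power2_norm_eq_inner)
  have e: "integrable M e" "(\<integral>\<omega>. e \<omega> \<partial>M) \<le> \<theta>\<^sup>2 * (\<integral>\<omega>. (norm (V k \<omega>))\<^sup>2 \<partial>M) + \<iota>"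
    using stoch_norm_cond_expectation[OF prob_space_axioms sub cond \<open>0 \<le> \<iota>\<close>, of e "\<lambda>\<omega>. (norm (V k \<omega>))\<^sup>2"]
      V mn by (auto simp: e_def V_def)
  have err: "0 \<le> err_sq k \<omega>" "err_sq k \<omega> \<le> e \<omega> / \<mu>" if "\<omega> \<in> space M" for \<omega>
    unfolding err_sq_def e_def using sq_bounds[OF that] by auto
  show int': "integrable M (err_sq k)"
  proof (rule Bochner_Integration.integrable_bound)
    show "integrable M (\<lambda>\<omega>. e \<omega> / \<mu>)" using e by simp
    show "AE \<omega> in M. norm (err_sq k \<omega>) \<le> norm (e \<omega> / \<mu>)"
      using err pos unfolding e_def by (intro AE_I2) simp
  qed measurable
  have "(\<integral>\<omega>. (norm (V k \<omega>))\<^sup>2 \<partial>M) \<le> (\<integral>\<omega>. Lt * grad_sq k \<omega> \<partial>M)"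
    using V N norm_V_le by (intro integral_mono) auto
  then have "\<theta>\<^sup>2 * (\<integral>\<omega>. (norm (V k \<omega>))\<^sup>2 \<partial>M) \<le> \<theta>\<^sup>2 * (Lt * (\<integral>\<omega>. grad_sq k \<omega> \<partial>M))"
    by (intro mult_left_mono) auto
  then have "(\<integral>\<omega>. e \<omega> \<partial>M) / \<mu> \<le> (\<theta>\<^sup>2 * (Lt * (\<integral>\<omega>. grad_sq k \<omega> \<partial>M)) + \<iota>) / \<mu>"
    using e(2) pos by (intro divide_right_mono) auto
  moreover have "(\<integral>\<omega>. err_sq k \<omega> \<partial>M) \<le> (\<integral>\<omega>. e \<omega> / \<mu> \<partial>M)"
    using int' e err by (intro integral_mono) auto
  ultimately show "(\<integral>\<omega>. err_sq k \<omega> \<partial>M) \<le> \<theta>\<^sup>2 * Lt / \<mu> * (\<integral>\<omega>. grad_sq k \<omega> \<partial>M) + \<iota> / \<mu>"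
    by (simp add: add_divide_distrib)
qed

end

theorem theorem4p3:
  fixes M :: "'w measure" and Z :: "'z measure"
    and \<zeta> :: "nat \<Rightarrow> 'w \<Rightarrow> 'z"
    and F :: "real^'n \<Rightarrow> 'z \<Rightarrow> real" and f :: "real^'n \<Rightarrow> real"
    and L Lt \<mu> fmin a \<theta>g itot :: real
    and w0 :: "real^'n"
    and S :: "nat \<Rightarrow> 'w \<Rightarrow> nat set"
    and \<gamma> :: "nat \<Rightarrow> nat \<Rightarrow> real"
    and w g :: "nat \<Rightarrow> 'w \<Rightarrow> real^'n"
    and H A :: "nat \<Rightarrow> 'w \<Rightarrow> real^'n^'n"
    and \<alpha> \<theta> \<iota> :: "nat \<Rightarrow> real"
  assumes "prob_space M" and "prob_space Z"
    and iid: "prob_space.indep_vars M (\<lambda>_. Z) \<zeta> UNIV" "\<And>i. distr M Z (\<zeta> i) = Z"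
    and F_C2: "\<And>z. z \<in> space Z \<Longrightarrow> twice_cont_diff (\<lambda>w. F w z)"
    and f_def: "\<And>w. integrable Z (F w)" "\<And>w. f w = integral\<^sup>L Z (F w)"
    and spectral: "spectral_upper_bound (space M) F \<zeta> L"
    and below: "\<And>w. fmin \<le> f w"
    and S_random: "\<And>k. S k \<in> M \<rightarrow>\<^sub>M count_space {T. finite T \<and> T \<noteq> {}}"
    and random: "\<And>k. w k \<in> borel_measurable M" "\<And>k. g k \<in> borel_measurable M"
      "\<And>k. H k \<in> borel_measurable M" "\<And>k. A k \<in> borel_measurable M"
    and weights: "\<And>k i. i \<le> k \<Longrightarrow> 0 \<le> \<gamma> k i \<and> \<gamma> k i \<le> 1" "\<And>k. (\<Sum>i\<le>k. \<gamma> k i) = 1"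
    and mu_pos: "0 < \<mu>"
    and H_def: "\<And>k \<omega>. \<omega> \<in> space M \<Longrightarrow> H k \<omega> = modified_abs \<mu> (averaged_hessian F \<zeta> S \<gamma> w k \<omega>)"
    and H_upper: "\<And>k \<omega>. \<omega> \<in> space M \<Longrightarrow> loewner_le (H k \<omega>) (Lt *\<^sub>R mat 1)" "Lt \<le> L + \<mu>"
    and w_init: "\<And>\<omega>. \<omega> \<in> space M \<Longrightarrow> w 0 \<omega> = w0"
    and w_step: "\<And>k \<omega>. \<omega> \<in> space M \<Longrightarrow>
      w (Suc k) \<omega> = w k \<omega> - \<alpha> k *\<^sub>R (matrix_inv (H k \<omega>) *v g k \<omega>)"
    and drawn_indep: "\<And>k. cond_indep M (past M Z \<zeta> S H g w k)
      (events_of M (g k)) (sample_events M Z \<zeta> (S k))"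
    and norm_cond: "\<And>k. stoch_norm_cond M (past M Z \<zeta> S H g w k) (A k) (g k)
      (\<lambda>\<omega>. grad f (w k \<omega>)) (\<theta> k) (\<iota> k)"
    and iota: "\<And>k. 0 < \<iota> k" "\<iota> sums itot"
  shows
    "((\<forall>k. \<forall>\<omega>\<in>space M. A k \<omega> = matrix_inv (H k \<omega>)) \<and>
      0 \<le> \<theta>g \<and> \<theta>g < 1 \<and> (\<forall>k. \<theta> k = \<theta>g) \<and>
      (\<forall>k. \<alpha> k = a) \<and> 0 < a \<and> a \<le> \<mu> / L
      \<longrightarrow>
      (\<forall>T::nat. 0 < T \<longrightarrow>
        (MIN k\<in>{0..T-1}. \<integral>\<^sup>+\<omega>. ennreal ((norm (grad f (w k \<omega>)))\<^sup>2) \<partial>M)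
          \<le> ennreal (Lt / ((1 - \<theta>g\<^sup>2) * real T) * (2 * (f w0 - fmin) / a + itot))) \<and>
      (AE \<omega> in M. summable (\<lambda>k. (norm (grad f (w k \<omega>)))\<^sup>2)) \<and>
      (AE \<omega> in M. (\<lambda>k. (norm (grad f (w k \<omega>)))\<^sup>2) \<longlonglongrightarrow> 0))
     \<and>
     ((\<forall>k. unbiased_for M (past_with M (past M Z \<zeta> S H g w k) (H k)) (g k)
              (\<lambda>\<omega>. grad f (w k \<omega>))) \<and>
      0 \<le> \<theta>g \<and> (\<forall>k. \<theta> k = \<theta>g) \<and> (\<forall>k. \<alpha> k = a) \<and>
      ((\<forall>k. \<forall>\<omega>\<in>space M. A k \<omega> = matrix_inv (H k \<omega>)) \<and>
         0 < a \<and> a \<le> \<mu> / (L * (1 + \<theta>g\<^sup>2))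
       \<or>
       (\<forall>k. \<forall>\<omega>\<in>space M. A k \<omega> = mat 1) \<and>
         0 < a \<and> a \<le> \<mu> / (L * (1 + \<theta>g\<^sup>2 * Lt / \<mu>)))
      \<longrightarrow>
      (\<forall>T::nat. 0 < T \<longrightarrow>
        (MIN k\<in>{0..T-1}. \<integral>\<^sup>+\<omega>. ennreal ((norm (grad f (w k \<omega>)))\<^sup>2) \<partial>M)
          \<le> ennreal (Lt / real T *
              (2 * (f w0 - fmin) / a + L * a * itot / (\<mu> * min 1 \<mu>)))) \<and>
      (AE \<omega> in M. summable (\<lambda>k. (norm (grad f (w k \<omega>)))\<^sup>2)) \<and>
      (AE \<omega> in M. (\<lambda>k. (norm (grad f (w k \<omega>)))\<^sup>2) \<longlonglongrightarrow> 0))"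
proof -
  interpret prob_space M by fact
  have \<zeta>: "\<zeta> i \<in> M \<rightarrow>\<^sub>M Z" for i using iid(1) unfolding indep_vars_def by auto
  note obj = expected_objective_quadratic_upper_bound[OF \<open>prob_space M\<close> \<zeta> iid(2) F_C2 f_def spectral]
  have sym: "transpose (averaged_hessian F \<zeta> S \<gamma> w k \<omega>) = averaged_hessian F \<zeta> S \<gamma> w k \<omega>"
    if "\<omega> \<in> space M" for k \<omega>
    by (intro averaged_hessian_symmetric F_C2 measurable_space[OF \<zeta> that])
  have upper: "x \<bullet> (H k \<omega> *v x) \<le> Lt * (norm x)\<^sup>2" if "\<omega> \<in> space M" for k \<omega> x
  proof -
    have "0 \<le> x \<bullet> ((Lt *\<^sub>R mat 1 - H k \<omega>) *v x)" using H_upper(1)[OF that] unfolding loewner_le_def by blast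
    also have "(Lt *\<^sub>R mat 1 - H k \<omega>) *v x = Lt *\<^sub>R x - H k \<omega> *v x"
      by (simp add: matrix_vector_mult_diff_rdistrib scaleR_matrix_vector_assoc[symmetric])
    finally show ?thesis by (simp add: inner_diff_right power2_norm_eq_inner)
  qed
  \<comment> \<open>The step length is constant only under the hypotheses of either part, so the
    interpretation is prepared here and carried out separately in each.\<close>
  have newton: "stochastic_newton M f L Lt \<mu> fmin a w0 w g H" if "0 < a" "\<forall>k. \<alpha> k = a"
  proof (unfold_locales, goal_cases)
    case 1 show ?case by (rule obj(1))
  next
    case 2 show ?case by (rule obj(2))
  next
    case 3 show ?case by (rule obj(3))
  next
    case (10 k \<omega>)
    show ?case unfolding H_def[OF \<open>\<omega> \<in> space M\<close>] by (rule modified_abs_symmetric_lower_bound(1)[OF sym]) fact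
  next
    case (11 k \<omega> x)
    show ?case unfolding H_def[OF \<open>\<omega> \<in> space M\<close>] by (rule modified_abs_symmetric_lower_bound(2)[OF sym]) fact
  qed (use that mu_pos below random upper w_init w_step in auto)
  let ?past = "\<lambda>k. past M Z \<zeta> S H g w k"
  have sub: "subalgebra M (?past k)" "w k \<in> borel_measurable (?past k)" for k
    by (rule subalgebra_past random S_random \<zeta>)+
  \<comment> \<open>The past is enlarged in two ways: by \<open>A k\<close> for the norm condition
    and by \<open>H k\<close> for unbiasedness. With \<open>A k = mat 1\<close> the two need not
    coincide.\<close>
  note sub_A = subalgebra_past_with(1)[OF sub(1) random(4)]
  note sub_H = subalgebra_past_with[OF sub(1) random(3)]
  have \<iota>0: "0 \<le> \<iota> k" for k using iota(1)[of k] by simp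
  show ?thesis
  proof (rule conjI; rule impI)
    assume hyp: "(\<forall>k. \<forall>\<omega>\<in>space M. A k \<omega> = matrix_inv (H k \<omega>)) \<and>
      0 \<le> \<theta>g \<and> \<theta>g < 1 \<and> (\<forall>k. \<theta> k = \<theta>g) \<and> (\<forall>k. \<alpha> k = a) \<and> 0 < a \<and> a \<le> \<mu> / L"
    interpret stochastic_newton M f L Lt \<mu> fmin a w0 w g H using newton hyp by blast
    have \<theta>: "0 < 1 - \<theta>g\<^sup>2" using hyp by (simp add: abs_square_less_1)
    define K where "K = Lt / (1 - \<theta>g\<^sup>2) * (2 * (f w0 - fmin) / a + itot)"
    \<comment> \<open>The general constant for \<open>c = a / 2 * (1 - \<theta>g^2)\<close> and
      \<open>b = a / 2\<close>.\<close>
    have K: "K = Lt / (a / 2 * (1 - \<theta>g\<^sup>2)) * (f w0 - fmin + a / 2 * itot)"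
      unfolding K_def using pos(3) \<theta> by (simp add: field_simps)
    have step: "integrable M (\<lambda>\<omega>. f (w (Suc k) \<omega>)) \<and>
        (\<integral>\<omega>. f (w (Suc k) \<omega>) \<partial>M) + a / 2 * (1 - \<theta>g\<^sup>2) * (\<integral>\<omega>. grad_sq k \<omega> \<partial>M)
          \<le> (\<integral>\<omega>. f (w k \<omega>) \<partial>M) + a / 2 * \<iota> k"
      if int: "integrable M (\<lambda>\<omega>. f (w k \<omega>))" for k
      using hyp newton_norm_cond[OF _ sub_A norm_cond \<iota>0 int]
      by (intro descent_biased[OF _ int]) (auto simp: P_def)
    have "0 < a / 2 * (1 - \<theta>g\<^sup>2)" "0 \<le> a / 2" using pos(3) \<theta> by auto
    note concl = expected_gradients_bounded[OF step this iota K]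
    have "K / real T = Lt / ((1 - \<theta>g\<^sup>2) * real T) * (2 * (f w0 - fmin) / a + itot)" for T
      by (simp add: K_def)
    with concl show "(\<forall>T::nat. 0 < T \<longrightarrow>
        (MIN k\<in>{0..T-1}. \<integral>\<^sup>+\<omega>. ennreal ((norm (grad f (w k \<omega>)))\<^sup>2) \<partial>M)
          \<le> ennreal (Lt / ((1 - \<theta>g\<^sup>2) * real T) * (2 * (f w0 - fmin) / a + itot))) \<and>
      (AE \<omega> in M. summable (\<lambda>k. (norm (grad f (w k \<omega>)))\<^sup>2)) \<and>
      (AE \<omega> in M. (\<lambda>k. (norm (grad f (w k \<omega>)))\<^sup>2) \<longlonglongrightarrow> 0)"
      by metis
  next
    assume hyp: "(\<forall>k. unbiased_for M (past_with M (?past k) (H k)) (g k) (\<lambda>\<omega>. grad f (w k \<omega>))) \<and>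
      0 \<le> \<theta>g \<and> (\<forall>k. \<theta> k = \<theta>g) \<and> (\<forall>k. \<alpha> k = a) \<and>
      ((\<forall>k. \<forall>\<omega>\<in>space M. A k \<omega> = matrix_inv (H k \<omega>)) \<and>
         0 < a \<and> a \<le> \<mu> / (L * (1 + \<theta>g\<^sup>2))
       \<or>
       (\<forall>k. \<forall>\<omega>\<in>space M. A k \<omega> = mat 1) \<and>
         0 < a \<and> a \<le> \<mu> / (L * (1 + \<theta>g\<^sup>2 * Lt / \<mu>)))"
    interpret stochastic_newton M f L Lt \<mu> fmin a w0 w g H using newton hyp by blast
    define s where "s = L * a\<^sup>2 / (2 * \<mu>)"
    have s: "0 \<le> s" unfolding s_def using pos by simp
    \<comment> \<open>\<open>1 / m\<close> dominates both \<open>1\<close> and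
      \<open>1 / \<mu>\<close>, so \<open>\<iota> k / m\<close> covers the error levels of both
      metrics.\<close>
    define m where "m = min 1 \<mu>"
    have m: "0 < m" "m \<le> 1" "m \<le> \<mu>" unfolding m_def using pos by auto
    define K where "K = Lt * (2 * (f w0 - fmin) / a + L * a * itot / (\<mu> * m))"
    have K: "K = Lt / (a / 2) * (f w0 - fmin + s / m * itot)"
      unfolding K_def s_def using pos m by (simp add: field_simps power2_eq_square)
    have unb: "unbiased_for M (past_with M (?past k) (H k)) (g k) (V k)" for k
      using hyp unfolding V_def[abs_def] by blast
    note descent = descent_unbiased[OF sub_H(1) sub_H(3)[OF sub(2)] sub_H(2) unb, folded s_def]
    have step: "integrable M (\<lambda>\<omega>. f (w (Suc k) \<omega>)) \<and>
        (\<integral>\<omega>. f (w (Suc k) \<omega>) \<partial>M) + a / 2 * (\<integral>\<omega>. grad_sq k \<omega> \<partial>M)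
          \<le> (\<integral>\<omega>. f (w k \<omega>) \<partial>M) + s / m * \<iota> k"
      if int: "integrable M (\<lambda>\<omega>. f (w k \<omega>))" for k
    proof -
      have "\<exists>i \<le> \<iota> k / m. integrable M (\<lambda>\<omega>. f (w (Suc k) \<omega>)) \<and>
        (\<integral>\<omega>. f (w (Suc k) \<omega>) \<partial>M) + a / 2 * (\<integral>\<omega>. grad_sq k \<omega> \<partial>M)
          \<le> (\<integral>\<omega>. f (w k \<omega>) \<partial>M) + s * i"
      \<comment> \<open>The step length bound stands under the quantifier over
        \<open>space M\<close>, so that the negation rules out the whole first alternative of
        \<open>hyp\<close>; in the positive case \<open>not_empty\<close> releases it.\<close>
      proof (cases "\<forall>k. \<forall>\<omega>\<in>space M. A k \<omega> = matrix_inv (H k \<omega>) \<and> a \<le> \<mu> / (L * (1 + \<theta>g\<^sup>2))")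
        case True
        have "\<iota> k \<le> \<iota> k / m" using m \<iota>0[of k] by (simp add: pos_le_divide_eq mult_left_le)
        moreover note descent[of "\<theta>g\<^sup>2" k "\<iota> k"]
        ultimately show ?thesis
          using True hyp int newton_norm_cond[OF _ sub_A norm_cond \<iota>0 int] not_empty
          by (intro exI[of _ "\<iota> k"] conjI) (auto simp: P_def)
      next
        case False
        then have A: "\<And>\<omega>. \<omega> \<in> space M \<Longrightarrow> A k \<omega> = mat 1" and a: "a \<le> \<mu> / (L * (1 + \<theta>g\<^sup>2 * Lt / \<mu>))"
          using hyp by blast+
        have "\<iota> k / \<mu> \<le> \<iota> k / m" using m pos \<iota>0[of k] by (intro divide_left_mono) auto
        moreover have c: "0 \<le> \<theta>g\<^sup>2 * Lt / \<mu>" using Lt_pos pos by simp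
        have "\<theta> k = \<theta>g" using hyp by blast
        note descent[OF c a int euclidean_norm_cond[OF A sub_A norm_cond \<iota>0 int, unfolded this]]
        ultimately show ?thesis by blast
      qed
      then obtain i where i: "i \<le> \<iota> k / m" "integrable M (\<lambda>\<omega>. f (w (Suc k) \<omega>))"
        "(\<integral>\<omega>. f (w (Suc k) \<omega>) \<partial>M) + a / 2 * (\<integral>\<omega>. grad_sq k \<omega> \<partial>M)
          \<le> (\<integral>\<omega>. f (w k \<omega>) \<partial>M) + s * i" by blast
      have "s * i \<le> s * (\<iota> k / m)" using i(1) s by (rule mult_left_mono)
      with i show ?thesis by simp
    qed
    have "0 < a / 2" "0 \<le> s / m" using pos(3) s m by auto
    note concl = expected_gradients_bounded[OF step this iota K]
    have "K / real T = Lt / real T * (2 * (f w0 - fmin) / a + L * a * itot / (\<mu> * min 1 \<mu>))" for T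
      by (simp add: K_def m_def)
    with concl show "(\<forall>T::nat. 0 < T \<longrightarrow>
        (MIN k\<in>{0..T-1}. \<integral>\<^sup>+\<omega>. ennreal ((norm (grad f (w k \<omega>)))\<^sup>2) \<partial>M)
          \<le> ennreal (Lt / real T *
              (2 * (f w0 - fmin) / a + L * a * itot / (\<mu> * min 1 \<mu>)))) \<and>
      (AE \<omega> in M. summable (\<lambda>k. (norm (grad f (w k \<omega>)))\<^sup>2)) \<and>
      (AE \<omega> in M. (\<lambda>k. (norm (grad f (w k \<omega>)))\<^sup>2) \<longlonglongrightarrow> 0)"
      by metis
  qed
qed

end
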